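(* Let $x>0$ be parameterized by $$x=\frac{\sin^4\left(\frac{\pi}{2}\theta\right)}{4\cos^2\left(\frac{\pi}{2}\theta\right)},\qquad 0<\theta<1 .$$ Then for every $x>0$ we have $$B_n(-x)=\frac{1}{(2\pi n)^{3/2}}\,\frac{\left(1+\sin(\frac{\pi}{2}\theta)\right)\left(1+\frac12\tan^2(\frac{\pi}{2}\theta)\right)}{\left(\frac12\tan(\frac{\pi}{2}\theta)\sqrt{1+\cos^2(\frac{\pi}{2}\theta)}\right)^{3/2}}\left\{\frac{1+\sin(\frac{\pi}{2}\theta)}{\cos(\frac{\pi}{2}\theta)}\right\}^{2n}\Bigl(\cos\{f(\theta)+n\pi\theta\}+o(1)\Bigr),$$ as $n\to\infty$, where the phase shift $f(\theta)$ is given explicitly by $$f(\theta)=2\arctan\left(\frac{\tan(\frac{\pi}{2}\theta)\left(1+\sin(\frac{\pi}{2}\theta)\right)}{2+\sin(\frac{\pi}{2}\theta)}\right)-\frac32\arctan\left(\frac{1}{\cos(\frac{\pi}{2}\theta)}\right).$$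
   Context: The Apéry polynomials are $B_n(z)=\sum_{k=0}^n\binom{n}{k}^2\binom{n+k}{k}^2z^k$. The asymptotics are pointwise: $x$ (equivalently $\theta$) is fixed and $o(1)$ denotes a quantity tending to $0$ as $n\to\infty$. *)

theory Defs
  imports "HOL-Analysis.Analysis"
begin

definition apery_poly :: "nat \<Rightarrow> 'a::comm_semiring_1 \<Rightarrow> 'a" where
  "apery_poly n z = (\<Sum>k\<le>n. of_nat ((n choose k)\<^sup>2 * ((n + k) choose k)\<^sup>2) * z ^ k)"

definition apery_param :: "real \<Rightarrow> real" where
  "apery_param \<theta> = sin (pi / 2 * \<theta>) ^ 4 / (4 * (cos (pi / 2 * \<theta>))\<^sup>2)"

definition apery_phase :: "real \<Rightarrow> real" where
  "apery_phase \<theta> =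
     2 * arctan (tan (pi / 2 * \<theta>) * (1 + sin (pi / 2 * \<theta>)) / (2 + sin (pi / 2 * \<theta>)))
     - 3 / 2 * arctan (1 / cos (pi / 2 * \<theta>))"

end

theory Submission
  imports
    Defs
    "HOL-Probability.Distributions"
    "HOL-Complex_Analysis.Cauchy_Integral_Theorem"
    "HOL-Real_Asymp.Real_Asymp"
begin

text \<open>
  The coefficients of the Apery polynomial are the squares of those of the Legendre polynomial
  \<open>P\<^sub>n (1 + 2 u)\<close>. Hence, with \<open>r = sqrt x\<close>, the value at \<open>- x\<close> is the mean over \<open>t\<close> of
  \<open>P\<^sub>n (1 + 2 \<i> r e\<^sup>i\<^sup>t) * P\<^sub>n (1 + 2 \<i> r e\<^sup>-\<^sup>i\<^sup>t)\<close>, and by conjugation symmetry it is the real part of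
  an integral over the half circle \<open>\<bar>t\<bar> \<le> pi / 2\<close> (\<open>apery_poly_eq_integral\<close>).

  For \<open>u\<close> off the cut \<open>P\<^sub>n (1 + 2 u)\<close> grows like \<open>growth u ^ (2 * n) / sqrt n\<close>, where
  \<open>growth u = sqrt u + sqrt (1 + u)\<close>; this follows from Laplace's integral
  (\<open>shifted_legendre_asymptotic\<close>). The modulus of \<open>growth u\<close> is governed by the sum of the distances
  of \<open>u\<close> from \<open>0\<close> and \<open>-1\<close>. On the half circle the product of the two growth rates therefore has a
  strict maximum at \<open>t = 0\<close> with Gaussian decay (\<open>norm_growth_saddle_circle_mult_le\<close>), and its
  second order behaviour there is explicit (\<open>growth_saddle_circle_second_order\<close>). So Laplace's
  method applies on the circle itself, with no deformation of the contour; it needs the Gaussian integral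
  with a complex parameter (\<open>laplace_method\<close>, \<open>complex_gaussian\<close>). The result is
  \<open>half_circle_integral_asymptotic\<close>: the integral is asymptotic to \<open>growth (\<i> r) ^ (4 * n)\<close> times
  an explicit complex constant and \<open>n powr (- 3 / 2)\<close>.

  The angle \<open>\<theta>\<close> makes all square roots explicit: \<open>growth (\<i> r)\<close> has the argument \<open>pi * \<theta> / 4\<close>, which
  produces the oscillation \<open>n * pi * \<theta>\<close>, and the modulus and the argument of the constant are the
  amplitude and the phase (\<open>saddle_contribution_polar\<close>, \<open>saddle_amplitude\<close>,
  \<open>arctan_phase_identity\<close>).
\<close>

section \<open>Laplace's method with a complex Gaussian\<close>

text \<open>
  Taking logarithms reduces this to \<open>Ln w / (w - 1) \<longlongrightarrow> 1\<close>. A base \<open>X n\<close> that varies with \<open>n\<close>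
  is needed because the integrands below are \<open>n\<close>-th powers evaluated at a point that moves with \<open>n\<close>.
\<close>
lemma power_tendsto_exp:
  fixes X :: "nat \<Rightarrow> complex"
  assumes "(\<lambda>n. of_nat n * (X n - 1)) \<longlonglongrightarrow> z"
  shows "(\<lambda>n. X n ^ n) \<longlonglongrightarrow> exp z"
proof -
  have "(\<lambda>n. 1 / of_nat n * (of_nat n * (X n - 1))) \<longlonglongrightarrow> 0 * z"
    by (intro tendsto_mult assms lim_1_over_n)
  moreover have "\<forall>\<^sub>F n in sequentially. 1 / of_nat n * (of_nat n * (X n - 1)) = X n - 1"
    using eventually_gt_at_top[of 0] by eventually_elim auto
  ultimately have "(\<lambda>n. X n - 1) \<longlonglongrightarrow> 0"
    by (simp add: filterlim_cong)
  hence X: "X \<longlonglongrightarrow> 1"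
    by (simp add: LIM_zero_iff)
  \<comment> \<open>The continuous extension of the quotient to \<open>w = 1\<close>, so that \<open>X n = 1\<close> needs no separate treatment.\<close>
  define g where "g = (\<lambda>w::complex. if w = 1 then 1 else (Ln w - Ln 1) / (w - 1))"
  have "(Ln has_field_derivative inverse 1) (at 1)"
    by (rule has_field_derivative_Ln) auto
  hence "((\<lambda>w. (Ln w - Ln 1) / (w - 1)) \<longlongrightarrow> 1) (at 1)"
    by (simp add: has_field_derivative_iff)
  hence "(g \<longlongrightarrow> g 1) (at 1)"
    by (subst LIM_equal[where g = "\<lambda>w. (Ln w - Ln 1) / (w - 1)"]) (auto simp: g_def)
  hence "isCont g 1"
    by (simp add: isCont_def)
  hence "(\<lambda>n. g (X n)) \<longlonglongrightarrow> g 1"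
    using X by (rule isCont_tendsto_compose)
  hence "(\<lambda>n. of_nat n * (X n - 1) * g (X n)) \<longlonglongrightarrow> z * 1"
    by (intro tendsto_mult assms) (simp add: g_def)
  hence "(\<lambda>n. exp (of_nat n * (X n - 1) * g (X n))) \<longlonglongrightarrow> exp z"
    by (intro tendsto_exp) simp
  moreover have "\<forall>\<^sub>F n in sequentially. X n \<noteq> 0"
    using tendsto_imp_eventually_ne[OF X, of 0] by simp
  hence "\<forall>\<^sub>F n in sequentially. exp (of_nat n * (X n - 1) * g (X n)) = X n ^ n"
  proof eventually_elim
    case (elim n)
    have "(X n - 1) * g (X n) = Ln (X n)"
      by (auto simp: g_def)
    hence "exp (of_nat n * (X n - 1) * g (X n)) = exp (of_nat n * Ln (X n))"
      by (simp add: mult.assoc)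
    also have "\<dots> = X n ^ n"
      using elim by (simp add: exp_of_nat_mult)
    finally show ?case .
  qed
  ultimately show ?thesis
    by (simp add: filterlim_cong)
qed

lemma real_gaussian:
  fixes l :: real
  assumes "l > 0"
  shows "has_bochner_integral lborel (\<lambda>s. exp (- l * s\<^sup>2)) (sqrt pi / sqrt l)"
proof -
  have "has_bochner_integral lborel (\<lambda>x::real. exp (- x\<^sup>2)) (2 *\<^sub>R (sqrt pi / 2))"
    by (rule has_bochner_integral_even_function[OF gaussian_moment_0]) simp
  hence "has_bochner_integral lborel (\<lambda>x::real. exp (- (0 + sqrt l * x)\<^sup>2)) ((2 *\<^sub>R (sqrt pi / 2)) /\<^sub>R \<bar>sqrt l\<bar>)"
    using assms by (subst (asm) lborel_has_bochner_integral_real_affine_iff[of "sqrt l" _ _ 0]) auto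
  thus ?thesis
    using assms by (simp add: power_mult_distrib field_simps)
qed

lemma integral_symmetric_interval_tendsto:
  fixes f :: "real \<Rightarrow> complex"
  assumes int: "integrable lborel f"
  shows "(\<lambda>N::nat. LINT t:{-real N..real N}|lborel. f t) \<longlonglongrightarrow> (LINT t|lborel. f t)"
  unfolding set_lebesgue_integral_def
proof (rule integral_dominated_convergence)
  show "integrable lborel (\<lambda>t. norm (f t))" "f \<in> borel_measurable lborel"
    using int by auto
  show "(\<lambda>t. indicat_real {-real N..real N} t *\<^sub>R f t) \<in> borel_measurable lborel" for N
    using int by auto
  show "AE t in lborel. (\<lambda>N. indicat_real {-real N..real N} t *\<^sub>R f t) \<longlonglongrightarrow> f t"
  proof (intro AE_I2 tendsto_eventually)
    fix t :: real
    have "\<forall>\<^sub>F N in sequentially. real N \<ge> \<bar>t\<bar>"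
      using filterlim_real_sequentially unfolding filterlim_at_top by auto
    thus "\<forall>\<^sub>F N in sequentially. indicat_real {-real N..real N} t *\<^sub>R f t = f t"
      by eventually_elim (auto simp: indicator_def)
  qed
qed (auto simp: indicator_def)

text \<open>
  With \<open>w = csqrt k\<close> the integral over \<open>[-N, N]\<close> is \<open>1 / w\<close> times the integral of \<open>exp (- z\<^sup>2)\<close> along
  the segment from \<open>- w N\<close> to \<open>w N\<close>, i.e. a difference of values of a primitive. As \<open>Re k > 0\<close>, the
  number \<open>w\<close> lies in the sector \<open>\<bar>Im w\<bar> < Re w\<close>, in which \<open>exp (- z\<^sup>2)\<close> decays, so the end points
  \<open>\<plusminus> w N\<close> may be moved to the real points \<open>\<plusminus> N\<close> at the cost of an error that vanishes as \<open>N\<close> grows.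
\<close>
lemma complex_gaussian:
  fixes k :: complex
  assumes k: "Re k > 0"
  shows "integrable lborel (\<lambda>s::real. exp (- k * (of_real s)\<^sup>2))"
    and "(LINT s|lborel. exp (- k * (of_real s)\<^sup>2)) = of_real (sqrt pi) / csqrt k"
proof -
  have int: "integrable lborel (\<lambda>s::real. exp (- k * (of_real s)\<^sup>2))" if "Re k > 0" for k
  proof (rule Bochner_Integration.integrable_bound)
    show "integrable lborel (\<lambda>s. exp (- Re k * s\<^sup>2))"
      using real_gaussian[OF that] by (simp add: has_bochner_integral_iff)
  qed (auto simp: Re_power2)
  show "integrable lborel (\<lambda>s::real. exp (- k * (of_real s)\<^sup>2))"
    by (rule int[OF k])
  define w where "w = csqrt k"
  have w2: "w\<^sup>2 = k" by (simp add: w_def)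
  have "Re w \<ge> 0" using csqrt_principal[of k] by (auto simp: w_def)
  moreover have "(Re w)\<^sup>2 > (Im w)\<^sup>2"
    using k arg_cong[OF w2, of Re] by (simp add: Re_power2)
  hence "\<bar>Re w\<bar> > \<bar>Im w\<bar>" by (metis abs_le_square_iff not_le)
  ultimately have w: "Re w > \<bar>Im w\<bar>" by simp
  define d where "d = min 1 (Re w - \<bar>Im w\<bar>)"
  have d: "d > 0" "d \<le> 1" "d \<le> Re w - Im w" "d \<le> Re w + Im w" using w by (auto simp: d_def)
  obtain F where F: "\<And>z::complex. (F has_field_derivative exp (- z\<^sup>2)) (at z)"
  proof (rule holomorphic_convex_primitive'[of UNIV "\<lambda>z::complex. exp (- z\<^sup>2)"])
    show "(\<lambda>z::complex. exp (- z\<^sup>2)) holomorphic_on UNIV"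
      by (intro holomorphic_intros)
  qed (auto intro: that)
  have FTC: "(LINT t:{-real N..real N}|lborel. exp (- v\<^sup>2 * (of_real t)\<^sup>2))
      = (F (v * of_nat N) - F (- v * of_nat N)) / v" if "v \<noteq> 0" for v N
  proof -
    have deriv: "((\<lambda>z. F (v * z) / v) has_field_derivative exp (- v\<^sup>2 * z\<^sup>2)) (at z)" for z
    proof -
      have "((\<lambda>z. F (v * z)) has_field_derivative exp (- (v * z)\<^sup>2) * v) (at z)"
        by (rule DERIV_chain2[OF F]) (auto intro!: derivative_eq_intros)
      hence "((\<lambda>z. F (v * z) / v) has_field_derivative exp (- (v * z)\<^sup>2) * v / v) (at z)"
        by (rule DERIV_cdivide)
      thus ?thesis using that by (simp add: power_mult_distrib)
    qed
    have "((\<lambda>t. F (v * complex_of_real t) / v) has_vector_derivative exp (- v\<^sup>2 * (of_real t)\<^sup>2)) (at t within {-real N..real N})" for t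
      by (rule has_vector_derivative_real_field[OF deriv])
    hence "(LINT t|lborel. indicator {-real N..real N} t *\<^sub>R exp (- v\<^sup>2 * (of_real t)\<^sup>2)) = F (v * complex_of_real (real N)) / v - F (v * complex_of_real (-real N)) / v"
      by (intro integral_FTC_atLeastAtMost) (auto intro!: continuous_intros)
    thus ?thesis by (simp add: set_lebesgue_integral_def diff_divide_distrib)
  qed
  have lim: "(\<lambda>N. F (v * of_nat N) - F (- v * of_nat N)) \<longlonglongrightarrow> v * (LINT t|lborel. exp (- v\<^sup>2 * (of_real t)\<^sup>2))"
    if "Re (v\<^sup>2) > 0" for v
  proof -
    have "v \<noteq> 0" using that by auto
    moreover have "(\<lambda>N. v * ((F (v * of_nat N) - F (- v * of_nat N)) / v)) \<longlonglongrightarrow> v * (LINT t|lborel. exp (- v\<^sup>2 * (of_real t)\<^sup>2))"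
      unfolding FTC[OF \<open>v \<noteq> 0\<close>, symmetric]
      by (intro tendsto_mult tendsto_const integral_symmetric_interval_tendsto int that)
    ultimately show ?thesis by simp
  qed
  have bound: "norm (F (e * w * of_nat N) - F (e * of_nat N)) \<le> exp (- (real N * d)\<^sup>2) * norm (e * w * of_nat N - e * of_nat N)" if "e = 1 \<or> e = -1" for e N
  proof (rule field_differentiable_bound)
    \<comment> \<open>A convex part of the sector (reflected if \<open>e = -1\<close>) that contains both end points and on which \<open>Re (z\<^sup>2) \<ge> (N d)\<^sup>2\<close>.\<close>
    let ?S = "{z. real N * d \<le> (1 - \<i>) \<bullet> (e * z)} \<inter> {z. real N * d \<le> (1 + \<i>) \<bullet> (e * z)}"
    have "convex {z. real N * d \<le> v \<bullet> (e * z)}" for v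
      using that convex_halfspace_ge[of "real N * d" v] convex_halfspace_ge[of "real N * d" "-v"] by auto
    thus "convex ?S" by (intro convex_Int)
    show "(F has_field_derivative exp (- z\<^sup>2)) (at z within ?S)" for z
      using F by (rule DERIV_subset) auto
    have "real N * d \<le> real N * (Re w - Im w)" "real N * d \<le> real N * (Re w + Im w)" "real N * d \<le> real N * 1"
      using d by (intro mult_left_mono; simp)+
    thus "e * w * of_nat N \<in> ?S" "e * of_nat N \<in> ?S"
      using that by (auto simp: inner_complex_def algebra_simps)
    fix z assume z: "z \<in> ?S"
    have "real N * d \<le> Re (e * z) - Im (e * z)" "real N * d \<le> Re (e * z) + Im (e * z)"
      using z by (auto simp: inner_complex_def)
    moreover have "0 \<le> real N * d" using d by simp
    ultimately have "(real N * d) * (real N * d) \<le> (Re (e * z) - Im (e * z)) * (Re (e * z) + Im (e * z))"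
      by (meson mult_mono order_trans)
    also have "\<dots> = Re (z\<^sup>2)" using that by (auto simp: Re_power2 power2_eq_square algebra_simps)
    finally show "norm (exp (- z\<^sup>2)) \<le> exp (- (real N * d)\<^sup>2)" by (simp add: power2_eq_square)
  qed
  have "(\<lambda>N. exp (- (real N * d)\<^sup>2) * (real N * norm (w - 1))) \<longlonglongrightarrow> 0"
    using d(1) by real_asymp
  hence 0: "(\<lambda>N. F (e * w * of_nat N) - F (e * of_nat N)) \<longlonglongrightarrow> 0" if "e = 1 \<or> e = -1" for e
  proof (rule Lim_null_comparison[rotated], intro always_eventually allI)
    fix N
    have "e * w * of_nat N - e * of_nat N = e * of_nat N * (w - 1)" by (simp add: algebra_simps)
    hence "norm (e * w * of_nat N - e * of_nat N) = real N * norm (w - 1)"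
      using that by (auto simp: norm_mult)
    thus "norm (F (e * w * of_nat N) - F (e * of_nat N)) \<le> exp (- (real N * d)\<^sup>2) * (real N * norm (w - 1))"
      using bound[OF that] by metis
  qed
  have "(\<lambda>N. (F (w * of_nat N) - F (- w * of_nat N))
     - (F (1 * w * of_nat N) - F (1 * of_nat N)) + (F (-1 * w * of_nat N) - F (-1 * of_nat N)))
      \<longlonglongrightarrow> w * (LINT t|lborel. exp (- w\<^sup>2 * (of_real t)\<^sup>2)) - 0 + 0"
    using k w2 by (intro tendsto_add tendsto_diff 0 lim) auto
  moreover have "(\<lambda>N. F (1 * of_nat N) - F (- 1 * of_nat N)) \<longlonglongrightarrow> 1 * (LINT t|lborel. exp (- 1\<^sup>2 * (of_real t)\<^sup>2))"
    by (rule lim) simp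
  moreover have "(LINT t|lborel. exp (- 1\<^sup>2 * (complex_of_real t)\<^sup>2)) = of_real (sqrt pi)"
  proof -
    have "exp (- 1\<^sup>2 * (complex_of_real t)\<^sup>2) = of_real (exp (- 1 * t\<^sup>2))" for t
      by (simp flip: exp_of_real)
    thus ?thesis
      using real_gaussian[of 1] by (simp only: integral_complex_of_real has_bochner_integral_iff) simp
  qed
  ultimately have "w * (LINT t|lborel. exp (- w\<^sup>2 * (of_real t)\<^sup>2)) = of_real (sqrt pi)"
    by (simp add: LIMSEQ_unique)
  moreover have "w \<noteq> 0" using w by auto
  ultimately show "(LINT s|lborel. exp (- k * (of_real s)\<^sup>2)) = of_real (sqrt pi) / csqrt k"
    by (simp add: w2 field_simps flip: w_def)
qed

text \<open>
  After the substitution \<open>t = s / sqrt n\<close> this is dominated convergence: the hypothesis on the size of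
  \<open>f n t\<close> turns into a Gaussian majorant that does not depend on \<open>n\<close>.
\<close>
lemma laplace_method:
  fixes f :: "nat \<Rightarrow> real \<Rightarrow> complex"
  assumes d: "d > 0" and k: "Re k > 0"
    and cont: "\<And>n. continuous_on {-L..L} (f n)"
    and L: "L > 0"
    and bound: "\<forall>\<^sub>F n in sequentially. \<forall>t\<in>{-L..L}. norm (f n t) \<le> C * exp (- d * real n * t\<^sup>2)"
    and lim: "\<And>s. (\<lambda>n. f n (s / sqrt (real n))) \<longlonglongrightarrow> A * exp (- k * (of_real s)\<^sup>2)"
  shows "(\<lambda>n. sqrt (real n) * integral {-L..L} (f n)) \<longlonglongrightarrow> A * (of_real (sqrt pi) / csqrt k)"
proof -
  define g where "g = (\<lambda>n s. indicat_real {-L..L} (s / sqrt (real n)) *\<^sub>R f n (s / sqrt (real n)))"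
  obtain N0 where N0: "\<And>n t. n \<ge> N0 \<Longrightarrow> t \<in> {-L..L} \<Longrightarrow> norm (f n t) \<le> C * exp (- d * real n * t\<^sup>2)"
    using bound unfolding eventually_sequentially by blast
  define N where "N = Suc N0"
  have C: "C \<ge> 0"
    using order_trans[OF norm_ge_zero N0[of N 0]] L by (simp add: N_def)
  have meas: "(\<lambda>t. indicat_real {-L..L} t *\<^sub>R f n t) \<in> borel_measurable borel" for n
    using borel_integrable_atLeastAtMost'[OF cont[of n]] by (auto simp: set_integrable_def)
  \<comment> \<open>The majorant is available for large indices only, hence the shift by \<open>N\<close>.\<close>
  have "(\<lambda>n. LINT s|lborel. g (n + N) s) \<longlonglongrightarrow> (LINT s|lborel. A * exp (- k * (of_real s)\<^sup>2))"
  proof (rule integral_dominated_convergence)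
    show "integrable lborel (\<lambda>s. C * exp (- d * s\<^sup>2))"
      using real_gaussian[OF d] by (auto simp: has_bochner_integral_iff)
    show "g (n + N) \<in> borel_measurable lborel" for n
      unfolding g_def using measurable_compose[OF _ meas, of "\<lambda>s. s / sqrt (real (n + N))" borel] by simp
    show "(\<lambda>s::real. A * exp (- k * (of_real s)\<^sup>2)) \<in> borel_measurable lborel"
      by (auto intro!: borel_measurable_continuous_onI continuous_intros)
    show "AE s in lborel. norm (g (n + N) s) \<le> C * exp (- d * s\<^sup>2)" for n
    proof (intro AE_I2)
      fix s
      have "real (n + N) > 0" by (simp add: N_def)
      hence "real (n + N) * (s / sqrt (real (n + N)))\<^sup>2 = s\<^sup>2"
        by (simp add: power_divide del: of_nat_add)
      thus "norm (g (n + N) s) \<le> C * exp (- d * s\<^sup>2)"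
        using N0[of "n + N" "s / sqrt (real (n + N))"] C
        by (auto simp: g_def N_def indicator_def mult.assoc simp del: of_nat_add)
    qed
    show "AE s in lborel. (\<lambda>n. g (n + N) s) \<longlonglongrightarrow> A * exp (- k * (of_real s)\<^sup>2)"
    proof (intro AE_I2 LIMSEQ_ignore_initial_segment)
      fix s
      have "(\<lambda>n. \<bar>s\<bar> / sqrt (real n)) \<longlonglongrightarrow> 0"
        by real_asymp
      hence "\<forall>\<^sub>F n in sequentially. \<bar>s\<bar> / sqrt (real n) < L"
        using L by (rule order_tendstoD)
      hence "\<forall>\<^sub>F n in sequentially. f n (s / sqrt (real n)) = g n s"
      proof eventually_elim
        case (elim n)
        hence "\<bar>s / sqrt (real n)\<bar> < L" by (simp add: abs_divide)
        hence "s / sqrt (real n) \<in> {-L..L}" unfolding abs_less_iff atLeastAtMost_iff by linarith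
        thus ?case by (simp add: g_def)
      qed
      with lim[of s] show "(\<lambda>n. g n s) \<longlonglongrightarrow> A * exp (- k * (of_real s)\<^sup>2)"
        by (rule Lim_transform_eventually)
    qed
  qed
  hence "(\<lambda>n. LINT s|lborel. g n s) \<longlonglongrightarrow> A * (of_real (sqrt pi) / csqrt k)"
    using complex_gaussian[OF k] by (auto dest: LIMSEQ_offset)
  moreover have "\<forall>\<^sub>F n in sequentially. (LINT s|lborel. g n s) = sqrt (real n) * integral {-L..L} (f n)"
    using eventually_gt_at_top[of 0]
  proof eventually_elim
    case (elim n)
    have "integral {-L..L} (f n) = (LINT t|lborel. indicat_real {-L..L} t *\<^sub>R f n t)"
      using set_borel_integral_eq_integral(2)[OF borel_integrable_atLeastAtMost'[OF cont[of n]]]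
      by (simp add: set_lebesgue_integral_def)
    also have "\<dots> = \<bar>1 / sqrt (real n)\<bar> *\<^sub>R (LINT s|lborel. g n s)"
      unfolding g_def using elim lborel_integral_real_affine[of "1 / sqrt (real n)" "\<lambda>t. indicat_real {-L..L} t *\<^sub>R f n t" 0]
      by simp
    finally show ?case using elim by (simp add: scaleR_conv_of_real)
  qed
  ultimately show ?thesis by (simp add: filterlim_cong)
qed

section \<open>Integral representations\<close>

text \<open>
  This is the Legendre polynomial \<open>P\<^sub>n\<close> at \<open>1 + 2 u\<close>.
\<close>
definition shifted_legendre :: "nat \<Rightarrow> complex \<Rightarrow> complex" where
  "shifted_legendre n u = (\<Sum>k\<le>n. of_nat ((n choose k) * ((n + k) choose k)) * u ^ k)"

text \<open>
  Expanding \<open>(1 + u) ^ (n - k)\<close> and collecting powers of \<open>u\<close> leaves a Vandermonde convolution. With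
  \<open>u = a\<^sup>2\<close> and \<open>1 + u = b\<^sup>2\<close> the new form is the sum of the squares of the coefficients of
  \<open>(a + b z) ^ n\<close>, which is what makes Laplace's integral below available.
\<close>
lemma shifted_legendre_altdef:
  "shifted_legendre n u = (\<Sum>k\<le>n. of_nat ((n choose k)\<^sup>2) * u ^ k * (1 + u) ^ (n - k))"
proof -
  have "(\<Sum>k\<le>n. of_nat ((n choose k)\<^sup>2) * u ^ k * (1 + u) ^ (n - k))
      = (\<Sum>k\<le>n. \<Sum>m\<in>{k..n}. of_nat ((n choose m) * ((n choose k) * (m choose (m - k)))) * u ^ m)"
  proof (rule sum.cong[OF refl])
    fix k assume k: "k \<in> {..n}"
    have "(1 + u) ^ (n - k) = (\<Sum>j\<le>n - k. of_nat ((n - k) choose j) * u ^ j)"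
      using binomial_ring[of u 1 "n - k"] by (simp add: add.commute)
    also have "\<dots> = (\<Sum>m\<in>{k..n}. of_nat ((n - k) choose (m - k)) * u ^ (m - k))"
      using k by (intro sum.reindex_bij_witness[of _ "\<lambda>m. m - k" "\<lambda>j. j + k"]) auto
    finally have "of_nat ((n choose k)\<^sup>2) * u ^ k * (1 + u) ^ (n - k)
        = (\<Sum>m\<in>{k..n}. of_nat ((n choose k)\<^sup>2) * u ^ k * (of_nat ((n - k) choose (m - k)) * u ^ (m - k)))"
      by (simp add: sum_distrib_left)
    also have "\<dots> = (\<Sum>m\<in>{k..n}. of_nat ((n choose m) * ((n choose k) * (m choose (m - k)))) * u ^ m)"
    proof (rule sum.cong[OF refl])
      fix m assume m: "m \<in> {k..n}"
      have "(n choose k)\<^sup>2 * ((n - k) choose (m - k)) = (n choose k) * ((n choose m) * (m choose k))"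
        using choose_mult[of k m n] m by (simp add: power2_eq_square)
      also have "m choose k = m choose (m - k)"
        using m by (intro binomial_symmetric) auto
      finally have "(n choose k)\<^sup>2 * ((n - k) choose (m - k)) = (n choose m) * ((n choose k) * (m choose (m - k)))"
        by (simp add: ac_simps)
      moreover have "u ^ k * u ^ (m - k) = u ^ m"
        using m by (simp flip: power_add)
      ultimately show "of_nat ((n choose k)\<^sup>2) * u ^ k * (of_nat ((n - k) choose (m - k)) * u ^ (m - k))
          = of_nat ((n choose m) * ((n choose k) * (m choose (m - k)))) * u ^ m"
        by (metis (no_types, lifting) mult.assoc mult.left_commute of_nat_mult)
    qed
    finally show "of_nat ((n choose k)\<^sup>2) * u ^ k * (1 + u) ^ (n - k)
        = (\<Sum>m\<in>{k..n}. of_nat ((n choose m) * ((n choose k) * (m choose (m - k)))) * u ^ m)" .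
  qed
  also have "\<dots> = (\<Sum>m\<le>n. \<Sum>k\<in>{..m}. of_nat ((n choose m) * ((n choose k) * (m choose (m - k)))) * u ^ m)"
    unfolding sum.Sigma[OF finite_atMost ballI[OF finite_atLeastAtMost]] sum.Sigma[OF finite_atMost ballI[OF finite_atMost]]
    by (rule sum.reindex_bij_witness[of _ "\<lambda>(m, k). (k, m)" "\<lambda>(k, m). (m, k)"]) auto
  also have "\<dots> = (\<Sum>m\<le>n. of_nat ((n choose m) * (\<Sum>k\<le>m. (n choose k) * (m choose (m - k)))) * u ^ m)"
    by (simp add: sum_distrib_left sum_distrib_right)
  also have "\<dots> = shifted_legendre n u"
    unfolding shifted_legendre_def vandermonde ..
  finally show ?thesis ..
qed

lemma has_integral_cis:
  assumes "c \<noteq> 0" "L \<ge> 0"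
  shows "((\<lambda>t. cis (c * t)) has_integral complex_of_real (2 * sin (c * L) / c)) {-L..L}"
proof -
  have deriv: "((\<lambda>z. exp (\<i> * of_real c * z) / (\<i> * of_real c)) has_field_derivative exp (\<i> * of_real c * z)) (at z)" for z
    using assms by (auto intro!: derivative_eq_intros)
  have "((\<lambda>t::real. exp (\<i> * of_real c * of_real t) / (\<i> * of_real c)) has_vector_derivative exp (\<i> * of_real c * of_real t)) (at t within {-L..L})" for t
    by (rule has_vector_derivative_real_field[OF deriv])
  hence "((\<lambda>t::real. exp (\<i> * of_real c * of_real t)) has_integral
      (exp (\<i> * of_real c * of_real L) / (\<i> * of_real c) - exp (\<i> * of_real c * of_real (-L)) / (\<i> * of_real c))) {-L..L}"
    using assms by (intro fundamental_theorem_of_calculus) auto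
  moreover have "exp (\<i> * of_real c * of_real t) = cis (c * t)" for t
    by (simp add: cis_conv_exp mult.assoc)
  ultimately have "((\<lambda>t. cis (c * t)) has_integral (cis (c * L) / (\<i> * of_real c) - cis (c * (-L)) / (\<i> * of_real c))) {-L..L}"
    by (simp only:)
  moreover have "cis (c * L) / (\<i> * of_real c) - cis (c * (-L)) / (\<i> * of_real c) = complex_of_real (2 * sin (c * L) / c)"
    using assms by (simp add: complex_eq_iff Re_divide Im_divide field_simps power2_eq_square)
  ultimately show ?thesis by (simp only:)
qed

lemma has_integral_cis_zero:
  assumes "L \<ge> 0"
  shows "((\<lambda>t. cis (0 * t)) has_integral complex_of_real (2 * L)) {-L..L}"
  using has_integral_const_real[of "1::complex" "-L" L] assms by (simp add: scaleR_conv_of_real)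

lemma has_integral_trig_sum:
  fixes c d :: "nat \<Rightarrow> complex"
  shows "((\<lambda>t. \<Sum>j\<le>n. \<Sum>k\<le>n. c j * d k * cis ((real j - real k) * t)) has_integral 
    (of_real (2 * pi) * (\<Sum>j\<le>n. c j * d j))) {-pi..pi}"
proof -
  have "((\<lambda>t. cis ((real j - real k) * t)) has_integral (if k = j then of_real (2 * pi) else 0)) {-pi..pi}" for j k :: nat
  proof (cases "j = k")
    case True
    thus ?thesis using has_integral_cis_zero[of pi] by simp
  next
    case False
    have "sin ((real j - real k) * pi) = 0"
      using sin_zero_iff_int2[of "(real j - real k) * pi"] by (auto intro!: exI[of _ "int j - int k"])
    thus ?thesis using has_integral_cis[of "real j - real k" pi] False by simp
  qed
  hence "((\<lambda>t. \<Sum>j\<le>n. \<Sum>k\<le>n. c j * d k * cis ((real j - real k) * t)) has_integral 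
    (\<Sum>j\<le>n. \<Sum>k\<le>n. c j * d k * (if k = j then of_real (2 * pi) else 0))) {-pi..pi}"
    by (intro has_integral_sum has_integral_mult_right) auto
  also have "(\<Sum>j\<le>n. \<Sum>k\<le>n. c j * d k * (if k = j then of_real (2 * pi) else 0)) = of_real (2 * pi) * (\<Sum>j\<le>n. c j * d j)"
    by (simp add: if_distrib[of "\<lambda>x. _ * x"] sum_distrib_left mult_ac cong: if_cong)
  finally show ?thesis .
qed

text \<open>
  Laplace's integral for Legendre polynomials: the integrand is \<open>(a + b cis t) ^ n * (a + b cis (-t)) ^ n\<close>,
  and integrating over a period extracts the constant term of this trigonometric polynomial.
\<close>
lemma shifted_legendre_laplace_integral:
  assumes "a\<^sup>2 = u" "b\<^sup>2 = 1 + u"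
  shows "((\<lambda>t. (a\<^sup>2 + b\<^sup>2 + 2 * a * b * of_real (cos t)) ^ n) has_integral of_real (2 * pi) * shifted_legendre n u) {-pi..pi}"
proof -
  define c where "c = (\<lambda>k. of_nat (n choose k) * a ^ k * b ^ (n - k))"
  have binom: "(a + b * cis s) ^ n = (\<Sum>k\<le>n. c k * cis (real (n - k) * s))" for s
    unfolding binomial_ring c_def by (intro sum.cong refl) (simp add: power_mult_distrib Complex.DeMoivre)
  have *: "(a\<^sup>2 + b\<^sup>2 + 2 * a * b * of_real (cos t)) ^ n
      = (\<Sum>j\<le>n. \<Sum>k\<le>n. c j * c k * cis ((real j - real k) * t))" for t
  proof -
    have "a\<^sup>2 + b\<^sup>2 + 2 * a * b * of_real (cos t) = (a + b * cis (-t)) * (a + b * cis t)"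
    proof -
      have "cis t + cis (-t) = 2 * of_real (cos t)" "cis (-t) * cis t = 1"
        by (auto simp: complex_eq_iff cis_mult)
      thus ?thesis by (simp add: algebra_simps power2_eq_square) (metis (no_types, opaque_lifting) mult.left_commute distrib_left mult.commute)
    qed
    hence "(a\<^sup>2 + b\<^sup>2 + 2 * a * b * of_real (cos t)) ^ n
      = (\<Sum>j\<le>n. c j * cis (real (n - j) * (-t))) * (\<Sum>k\<le>n. c k * cis (real (n - k) * t))"
      by (simp add: power_mult_distrib binom)
    also have "\<dots> = (\<Sum>j\<le>n. \<Sum>k\<le>n. c j * c k * (cis (real (n - j) * (-t)) * cis (real (n - k) * t)))"
      unfolding sum_product by (intro sum.cong refl) (simp add: mult_ac)
    also have "\<dots> = (\<Sum>j\<le>n. \<Sum>k\<le>n. c j * c k * cis ((real j - real k) * t))"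
      by (intro sum.cong refl arg_cong2[of _ _ _ _ "(*)"]) (simp add: cis_mult of_nat_diff algebra_simps)
    finally show ?thesis .
  qed
  have "(\<Sum>j\<le>n. c j * c j) = shifted_legendre n u"
    unfolding shifted_legendre_altdef c_def assms(2)[symmetric] unfolding assms(1)[symmetric]
    by (intro sum.cong refl) (simp add: power2_eq_square power_mult_distrib mult_ac)
  thus ?thesis unfolding * using has_integral_trig_sum[where n = n and c = c and d = c] by simp
qed

text \<open>
  The coefficients of the Apery polynomial are the squares of those of \<open>shifted_legendre n\<close>, so it
  is a constant term of a product of two such polynomials on the circle of radius \<open>r\<close>. Half of
  the circle suffices because the other half contributes the complex conjugate: on the half circle
  a frequency \<open>j - k\<close> that is even and nonzero integrates to zero, and for an odd one the factor
  \<open>\<i> ^ (j + k)\<close> is purely imaginary.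
\<close>
lemma apery_poly_eq_integral:
  fixes r :: real
  shows "pi * apery_poly n (- (r\<^sup>2)) = Re (integral {-(pi/2)..pi/2} (\<lambda>t.
      shifted_legendre n (\<i> * of_real r * cis t) * shifted_legendre n (\<i> * of_real r * cis (-t))))"
proof -
  define a where "a = (\<lambda>k. real ((n choose k) * ((n + k) choose k)))"
  define I where "I = (\<lambda>j k :: nat. if j = k then pi else 2 * sin ((real j - real k) * (pi/2)) / (real j - real k))"
  have I: "((\<lambda>t. cis ((real j - real k) * t)) has_integral of_real (I j k)) {-(pi/2)..pi/2}" for j k
    using has_integral_cis_zero[of "pi/2"] has_integral_cis[of "real j - real k" "pi/2"]
    by (cases "j = k") (auto simp: I_def)
  have prod: "shifted_legendre n (\<i> * of_real r * cis t) * shifted_legendre n (\<i> * of_real r * cis (-t))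
    = (\<Sum>j\<le>n. \<Sum>k\<le>n. of_real (a j * a k * r ^ (j + k)) * \<i> ^ (j + k) * cis ((real j - real k) * t))" for t
  proof -
    have "cis t ^ j * cis (-t) ^ k = cis ((real j - real k) * t)" for j k
      by (simp add: Complex.DeMoivre cis_mult algebra_simps)
    thus ?thesis
      unfolding shifted_legendre_def sum_product a_def
      by (intro sum.cong refl) (simp add: power_mult_distrib power_add mult_ac)
  qed
  have "integral {-(pi/2)..pi/2} (\<lambda>t.
      shifted_legendre n (\<i> * of_real r * cis t) * shifted_legendre n (\<i> * of_real r * cis (-t)))
     = (\<Sum>j\<le>n. \<Sum>k\<le>n. of_real (a j * a k * r ^ (j + k)) * \<i> ^ (j + k) * of_real (I j k))"
    unfolding prod by (intro integral_unique has_integral_sum has_integral_mult_right I) auto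
  also have "Re \<dots> = (\<Sum>j\<le>n. \<Sum>k\<le>n. a j * a k * r ^ (j + k) * (Re (\<i> ^ (j + k)) * I j k))"
    by (simp add: mult.assoc)
  also have "\<dots> = (\<Sum>j\<le>n. \<Sum>k\<le>n. if k = j then pi * ((a j)\<^sup>2 * (-(r\<^sup>2)) ^ j) else 0)"
  proof (intro sum.cong refl)
    fix j k
    show "a j * a k * r ^ (j + k) * (Re (\<i> ^ (j + k)) * I j k) = (if k = j then pi * ((a j)\<^sup>2 * (-(r\<^sup>2)) ^ j) else 0)"
    proof (cases "k = j")
      case True
      have "\<i> ^ (j + j) = of_real ((-1) ^ j)" by (simp flip: mult_2 add: power_mult)
      moreover have "r ^ (j + j) = (r\<^sup>2) ^ j" by (simp flip: mult_2 add: power_mult)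
      moreover have "(-(r\<^sup>2)) ^ j = (-1) ^ j * (r\<^sup>2) ^ j" by (metis power_minus)
      ultimately show ?thesis using True by (simp add: I_def power2_eq_square)
    next
      case False
      have "Re (\<i> ^ (j + k)) * I j k = 0"
      proof (cases "even (j + k)")
        case True
        then obtain m :: int where m: "int j - int k = 2 * m" by (metis even_diff evenE even_of_nat of_nat_add)
        hence "real j - real k = 2 * of_int m" by (metis of_int_diff of_int_mult of_int_numeral of_int_of_nat_eq)
        hence "sin ((real j - real k) * (pi/2)) = 0" by (simp add: sin_zero_iff_int2)
        thus ?thesis using False by (simp add: I_def)
      next
        case odd: False
        then obtain m where "j + k = Suc (2 * m)" by (metis oddE Suc_eq_plus1)
        hence "\<i> ^ (j + k) = \<i> * of_real ((-1) ^ m)" by (simp add: power_mult)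
        thus ?thesis by simp
      qed
      thus ?thesis using False by simp
    qed
  qed
  also have "\<dots> = pi * apery_poly n (- (r\<^sup>2))"
    by (simp add: apery_poly_def a_def sum_distrib_left power_mult_distrib)
  finally show ?thesis ..
qed

section \<open>Legendre polynomials off the cut\<close>

text \<open>
  For \<open>w = 1 + 2 u\<close> the square \<open>(growth u)\<^sup>2\<close> is \<open>w + sqrt (w\<^sup>2 - 1)\<close>, the exponential growth rate of
  \<open>P\<^sub>n w\<close>. Writing it as a square makes the principal branches usable on the whole plane cut along the
  nonpositive reals.
\<close>
definition growth :: "complex \<Rightarrow> complex" where
  "growth u = csqrt u + csqrt (1 + u)"

text \<open>
  The base of Laplace's integrand, divided by \<open>(growth u)\<^sup>2\<close>, is \<open>1 - curvature u * (1 - cos t)\<close>.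
\<close>
definition curvature :: "complex \<Rightarrow> complex" where
  "curvature u = 2 * csqrt u * csqrt (1 + u) / (growth u)\<^sup>2"

lemma growth_mult_conjugate: "growth u * (csqrt (1 + u) - csqrt u) = 1"
  by (simp add: growth_def algebra_simps flip: power2_eq_square)

lemma growth_nonzero: "growth u \<noteq> 0"
  using growth_mult_conjugate[of u] by auto

text \<open>
  The two numbers \<open>csqrt (1 + u) \<plusminus> csqrt u\<close> are inverse to each other, and the one with the plus sign is
  the larger because principal square roots of \<open>u\<close> and \<open>1 + u\<close> enclose an angle of at most \<open>pi / 2\<close>.
\<close>
lemma norm_growth_ge_1: "norm (growth u) \<ge> 1"
proof -
  define a b where "a = csqrt u" and "b = csqrt (1 + u)"
  have "Re a \<ge> 0" "Re b \<ge> 0"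
    using csqrt_principal[of u] csqrt_principal[of "1 + u"] by (auto simp: a_def b_def)
  moreover have "Im a * Im b \<ge> 0"
    using complex_Re_le_cmod[of u] complex_Re_le_cmod[of "1 + u"]
    by (cases "Im u = 0") (auto simp: a_def b_def sgn_if intro!: mult_nonneg_nonneg)
  ultimately have "0 \<le> 4 * (Re a * Re b + Im a * Im b)"
    by simp
  also have "\<dots> = (norm (a + b))\<^sup>2 - (norm (b - a))\<^sup>2"
    unfolding cmod_power2 plus_complex.sel minus_complex.sel by algebra
  finally have "(norm (b - a))\<^sup>2 \<le> (norm (a + b))\<^sup>2" by simp
  hence "norm (b - a) \<le> norm (a + b)"
    by (rule power2_le_imp_le) simp
  moreover have "norm (a + b) * norm (b - a) = 1"
    using arg_cong[OF growth_mult_conjugate[of u], of norm] by (simp add: norm_mult growth_def a_def b_def)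
  ultimately show ?thesis
    unfolding growth_def a_def[symmetric] b_def[symmetric]
    by (smt (verit, best) mult_less_cancel_left1 mult_right_mono norm_ge_zero)
qed

text \<open>
  The level sets of \<open>norm (growth u)\<close> are the ellipses with foci \<open>0\<close> and \<open>-1\<close>. The identity is the parallelogram
  law for the two inverse numbers \<open>csqrt (1 + u) \<plusminus> csqrt u\<close>.
\<close>
lemma norm_growth_joukowsky:
  "(norm (growth u))\<^sup>2 + 1 / (norm (growth u))\<^sup>2 = 2 * (norm u + norm (1 + u))"
proof -
  define a b where "a = csqrt u" and "b = csqrt (1 + u)"
  have g: "growth u = a + b" by (simp add: growth_def a_def b_def)
  have "b - a = 1 / growth u"
    using growth_mult_conjugate[of u] growth_nonzero[of u] by (simp add: a_def b_def field_simps)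
  hence "(norm (growth u))\<^sup>2 + 1 / (norm (growth u))\<^sup>2 = (norm (a + b))\<^sup>2 + (norm (b - a))\<^sup>2"
    by (simp add: g norm_divide power_divide)
  also have "\<dots> = 2 * ((norm a)\<^sup>2 + (norm b)\<^sup>2)"
    unfolding cmod_power2 by (simp add: power2_eq_square algebra_simps)
  also have "(norm a)\<^sup>2 = norm u"
    unfolding a_def by (metis norm_power power2_csqrt)
  also have "(norm b)\<^sup>2 = norm (1 + u)"
    unfolding b_def by (metis norm_power power2_csqrt)
  finally show ?thesis .
qed

lemma norm_growth_gt_1:
  assumes "u \<notin> \<real>\<^sub>\<le>\<^sub>0"
  shows "norm (growth u) > 1"
proof -
  have "norm u + norm (1 + u) \<noteq> 1"
  proof
    assume *: "norm u + norm (1 + u) = 1"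
    have "norm (1 + u) + norm (-u) = norm ((1 + u) + (-u))" using * by simp
    hence eq: "norm (1 + u) *\<^sub>R (-u) = norm (-u) *\<^sub>R (1 + u)"
      by (metis norm_triangle_eq)
    have "(norm u + norm (1 + u)) * Im u = 0"
      using arg_cong[OF eq, of Im] by (simp add: distrib_right)
    hence "Im u = 0" unfolding * by simp
    have "(norm u + norm (1 + u)) * Re u = - norm u"
      using arg_cong[OF eq, of Re] by (simp add: distrib_right distrib_left)
    hence "Re u \<le> 0" unfolding * by simp
    with \<open>Im u = 0\<close> have "u \<in> \<real>\<^sub>\<le>\<^sub>0" by (simp add: complex_nonpos_Reals_iff)
    with assms show False by simp
  qed
  with norm_growth_joukowsky[of u] have "norm (growth u) \<noteq> 1" by auto
  with norm_growth_ge_1[of u] show ?thesis by simp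
qed

lemma curvature_altdef: "curvature u = (1 - 1 / (growth u) ^ 4) / 2"
proof -
  define a b where "a = csqrt u" and "b = csqrt (1 + u)"
  have g: "growth u = a + b" by (simp add: growth_def a_def b_def)
  have nz: "a + b \<noteq> 0" using growth_nonzero[of u] by (simp add: g)
  have "(a + b) * (b - a) = 1" using growth_mult_conjugate[of u] by (simp add: g a_def b_def)
  hence "((a + b) * (b - a))\<^sup>2 = 1" by simp
  define P where "P = (a + b)\<^sup>2"
  have P: "P \<noteq> 0" using nz by (simp add: P_def)
  have "(4 * a * b) * P = P * P - 1"
    using \<open>((a + b) * (b - a))\<^sup>2 = 1\<close> unfolding P_def by algebra
  hence "2 * a * b = (P * P - 1) / (2 * P)" using P by (simp add: eq_divide_eq mult_ac)
  hence "2 * a * b / P = (1 - 1 / (P * P)) / 2"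
    using P by (simp add: field_simps)
  moreover have "growth u ^ 4 = P * P" unfolding g P_def by algebra
  ultimately show ?thesis by (simp add: curvature_def g P_def a_def b_def)
qed

lemma one_div_power4_less:
  fixes x :: real
  assumes "1 < x"
  shows "1 / x ^ 4 < 1"
  using one_less_power[OF assms, of 4] assms by (subst divide_less_eq_1_pos) auto

lemma Re_curvature_pos:
  assumes "u \<notin> \<real>\<^sub>\<le>\<^sub>0"
  shows "Re (curvature u) > 0"
proof -
  have "Re (1 / growth u ^ 4) \<le> norm (1 / growth u ^ 4)" by (rule complex_Re_le_cmod)
  also have "\<dots> < 1"
    using one_div_power4_less[OF norm_growth_gt_1[OF assms]] by (simp add: norm_divide norm_power)
  finally show ?thesis by (simp add: curvature_altdef)
qed

text \<open>
  Concavity of the sine on \<open>[0, pi / 2]\<close> puts its graph above the chord.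
\<close>
lemma jordan_inequality:
  assumes "\<bar>t\<bar> \<le> pi / 2"
  shows "(2 / pi * t)\<^sup>2 \<le> (sin t)\<^sup>2"
proof -
  have *: "2 / pi * t \<le> sin t" if "t \<in> {0..pi/2}" for t
  proof -
    have "concave_on {0..pi/2} sin"
      unfolding concave_on_def
    proof (rule f''_ge0_imp_convex)
      show "((\<lambda>x. - sin x) has_real_derivative - cos x) (at x)" for x
        by (auto intro!: derivative_eq_intros)
      show "((\<lambda>x. - cos x) has_real_derivative sin x) (at x)" for x
        by (auto intro!: derivative_eq_intros)
      show "sin x \<ge> 0" if "x \<in> {0..pi/2}" for x
        using that by (intro sin_ge_zero) auto
    qed auto
    hence "sin ((1 - 2 / pi * t) *\<^sub>R 0 + (2 / pi * t) *\<^sub>R (pi/2)) \<ge> (1 - 2 / pi * t) * sin 0 + (2 / pi * t) * sin (pi/2)"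
      using that by (intro concave_onD) (auto simp: field_simps)
    thus ?thesis by simp
  qed
  have "2 / pi * \<bar>t\<bar> \<le> sin \<bar>t\<bar>" using assms by (intro *) auto
  hence "(2 / pi * \<bar>t\<bar>)\<^sup>2 \<le> (sin \<bar>t\<bar>)\<^sup>2" by (intro power_mono) auto
  thus ?thesis by (cases "t \<ge> 0") (simp_all add: power_mult_distrib power_divide)
qed

lemma one_minus_cos_ge:
  assumes "\<bar>t\<bar> \<le> pi"
  shows "1 - cos t \<ge> 2 * t\<^sup>2 / pi\<^sup>2"
proof -
  have "1 - cos t = 2 * (sin (t / 2))\<^sup>2"
    using cos_double_sin[of "t / 2"] by simp
  also have "\<dots> \<ge> 2 * (2 / pi * (t / 2))\<^sup>2"
    using assms by (intro mult_left_mono jordan_inequality) auto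
  finally show ?thesis by (simp add: power_divide)
qed

text \<open>
  The base of the power is a convex combination of \<open>1\<close> and \<open>1 / growth u ^ 4\<close> with weights \<open>(1 \<plusminus> cos t) / 2\<close>,
  so its modulus is at most \<open>1 - (1 - 1 / \<mu> ^ 4) * (1 - cos t) / 2\<close>. The decay rate is
  expressed by a lower bound \<open>\<mu>\<close> for \<open>norm (growth u)\<close> to make the estimate uniform in \<open>u\<close>.
\<close>
lemma norm_laplace_integrand_power_le:
  assumes t: "\<bar>t\<bar> \<le> pi" and \<mu>: "1 \<le> \<mu>" "\<mu> \<le> norm (growth u)"
  shows "norm ((1 - curvature u * (1 - of_real (cos t))) ^ n) \<le> exp (- ((1 - 1 / \<mu> ^ 4) / pi\<^sup>2) * real n * t\<^sup>2)"
proof -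
  define q where "q = 1 / \<mu> ^ 4"
  have q: "q \<le> 1" using one_le_power[OF \<mu>(1), of 4] \<mu>(1) unfolding q_def by (subst divide_le_eq_1_pos) auto
  have "\<mu> ^ 4 \<le> norm (growth u) ^ 4" using \<mu> by (intro power_mono) auto
  hence q_ge: "1 / norm (growth u) ^ 4 \<le> q"
    unfolding q_def using \<mu> by (intro divide_left_mono mult_pos_pos zero_less_power) auto
  have "1 - curvature u * (1 - of_real (cos t)) = of_real ((1 + cos t) / 2) + (1 / growth u ^ 4) * of_real ((1 - cos t) / 2)"
    unfolding curvature_altdef of_real_divide of_real_add of_real_diff of_real_1 of_real_numeral
    by (simp only: diff_divide_distrib add_divide_distrib left_diff_distrib right_diff_distrib times_divide_eq_left mult_1_left mult_1_right) (simp add: algebra_simps)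
  also have "norm \<dots> \<le> (1 + cos t) / 2 + q * ((1 - cos t) / 2)"
  proof (rule norm_triangle_mono)
    show "norm (complex_of_real ((1 + cos t) / 2)) \<le> (1 + cos t) / 2"
      unfolding norm_of_real using cos_ge_minus_one[of t] by (simp del: cos_ge_minus_one)
    have "norm ((1 / growth u ^ 4) * of_real ((1 - cos t) / 2)) = 1 / norm (growth u) ^ 4 * ((1 - cos t) / 2)"
      unfolding norm_mult norm_of_real by (simp add: norm_divide norm_power)
    also have "\<dots> \<le> q * ((1 - cos t) / 2)" by (intro mult_right_mono q_ge) simp
    finally show "norm ((1 / growth u ^ 4) * of_real ((1 - cos t) / 2)) \<le> q * ((1 - cos t) / 2)" .
  qed
  also have "\<dots> = 1 + - ((1 - q) * ((1 - cos t) / 2))" by (simp add: field_simps)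
  also have "\<dots> \<le> exp (- ((1 - q) * ((1 - cos t) / 2)))" by (rule exp_ge_add_one_self)
  also have "(1 - q) * ((2 * t\<^sup>2 / pi\<^sup>2) / 2) \<le> (1 - q) * ((1 - cos t) / 2)"
    using q one_minus_cos_ge[OF t] by (intro mult_left_mono divide_right_mono) auto
  hence "exp (- ((1 - q) * ((1 - cos t) / 2))) \<le> exp (- ((1 - q) / pi\<^sup>2 * t\<^sup>2))" by simp
  finally have "norm (1 - curvature u * (1 - of_real (cos t))) ^ n \<le> exp (- ((1 - q) / pi\<^sup>2 * t\<^sup>2)) ^ n"
    by (intro power_mono) auto
  thus ?thesis by (simp add: norm_power q_def mult_ac flip: exp_of_nat_mult)
qed

lemma shifted_legendre_normalised:
  "shifted_legendre n u / growth u ^ (2 * n)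
     = 1 / (2 * pi) * integral {-pi..pi} (\<lambda>t. (1 - curvature u * (1 - of_real (cos t))) ^ n)"
proof -
  define a b where "a = csqrt u" and "b = csqrt (1 + u)"
  have g: "growth u = a + b" by (simp add: growth_def a_def b_def)
  have "a\<^sup>2 + b\<^sup>2 + 2 * a * b * of_real (cos t) = growth u ^ 2 * (1 - curvature u * (1 - of_real (cos t)))" for t
  proof -
    have "growth u ^ 2 * curvature u = 2 * a * b"
      using growth_nonzero[of u] by (simp add: curvature_def a_def b_def)
    moreover have "growth u ^ 2 = a\<^sup>2 + b\<^sup>2 + 2 * a * b"
      by (simp add: g power2_sum)
    ultimately show ?thesis by (simp add: right_diff_distrib flip: mult.assoc)
  qed
  hence "(a\<^sup>2 + b\<^sup>2 + 2 * a * b * of_real (cos t)) ^ n = growth u ^ (2 * n) * (1 - curvature u * (1 - of_real (cos t))) ^ n" for t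
    by (simp add: power_mult power_mult_distrib)
  with shifted_legendre_laplace_integral[of a u b n]
  have "integral {-pi..pi} (\<lambda>t. growth u ^ (2 * n) * (1 - curvature u * (1 - of_real (cos t))) ^ n) = of_real (2 * pi) * shifted_legendre n u"
    by (intro integral_unique) (simp add: a_def b_def)
  thus ?thesis using growth_nonzero[of u] by (simp add: field_simps)
qed

lemma continuous_laplace_integrand: "continuous_on A (\<lambda>t. (1 - curvature u * (1 - of_real (cos t))) ^ n)"
  by (intro continuous_intros)

text \<open>
  This crude bound remains valid up to the cut, where \<open>norm (growth u)\<close> tends to \<open>1\<close> and the bound with the
  factor \<open>sqrt n\<close> breaks down.
\<close>
lemma norm_shifted_legendre_normalised_le_1: "norm (shifted_legendre n u / growth u ^ (2 * n)) \<le> 1"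
proof -
  have "norm (integral {-pi..pi} (\<lambda>t. (1 - curvature u * (1 - of_real (cos t))) ^ n)) \<le> 1 * (pi - (-pi))"
  proof (rule integral_bound)
    fix t assume t: "t \<in> {-pi..pi}"
    show "norm ((1 - curvature u * (1 - of_real (cos t))) ^ n) \<le> 1"
      using norm_laplace_integrand_power_le[of t 1 u n] t norm_growth_ge_1[of u] by auto
  qed (auto intro: continuous_laplace_integrand)
  thus ?thesis unfolding shifted_legendre_normalised by (simp add: norm_mult norm_divide)
qed

lemma gaussian_integral_interval_le:
  assumes "l > 0"
  shows "integral {-L..L} (\<lambda>t. exp (- l * t\<^sup>2)) \<le> sqrt pi / sqrt l"
proof -
  note G = real_gaussian[OF assms, unfolded has_bochner_integral_iff]
  have "set_integrable lborel {-L..L} (\<lambda>t. exp (- l * t\<^sup>2))"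
    by (intro borel_integrable_atLeastAtMost' continuous_intros)
  hence "integral {-L..L} (\<lambda>t. exp (- l * t\<^sup>2)) = (LINT t|lborel. indicator {-L..L} t *\<^sub>R exp (- l * t\<^sup>2))"
    by (subst set_borel_integral_eq_integral(2)[symmetric]) (auto simp: set_lebesgue_integral_def)
  also have "\<dots> \<le> (LINT t|lborel. exp (- l * t\<^sup>2))"
    using \<open>set_integrable lborel {-L..L} _\<close> G
    by (intro integral_mono) (auto simp: set_integrable_def indicator_def)
  also have "\<dots> = sqrt pi / sqrt l" using G by simp
  finally show ?thesis .
qed

lemma norm_shifted_legendre_normalised_le:
  assumes \<mu>: "1 < \<mu>" "\<mu> \<le> norm (growth u)" and n: "n > 0"
  shows "sqrt n * norm (shifted_legendre n u / growth u ^ (2 * n)) \<le> 1 / (2 * pi) * (sqrt pi / sqrt ((1 - 1 / \<mu> ^ 4) / pi\<^sup>2))"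
proof -
  define d where "d = (1 - 1 / \<mu> ^ 4) / pi\<^sup>2"
  have d: "d > 0" using one_div_power4_less[OF \<mu>(1)] by (simp add: d_def)
  have "norm (integral {-pi..pi} (\<lambda>t. (1 - curvature u * (1 - of_real (cos t))) ^ n)) \<le> integral {-pi..pi} (\<lambda>t. exp (- (d * n) * t\<^sup>2))"
  proof (rule integral_norm_bound_integral)
    fix t assume t: "t \<in> {-pi..pi}"
    show "norm ((1 - curvature u * (1 - of_real (cos t))) ^ n) \<le> exp (- (d * n) * t\<^sup>2)"
      using norm_laplace_integrand_power_le[of t \<mu> u n] t \<mu> by (auto simp: d_def)
  qed (auto intro!: integrable_continuous_interval continuous_laplace_integrand continuous_intros)
  also have "\<dots> \<le> sqrt pi / sqrt (d * n)"
    using d n by (intro gaussian_integral_interval_le) auto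
  finally have "norm (shifted_legendre n u / growth u ^ (2 * n)) \<le> 1 / (2 * pi) * (sqrt pi / sqrt (d * n))"
    unfolding shifted_legendre_normalised norm_mult by (intro mult_mono) (auto simp: norm_divide)
  hence "sqrt n * norm (shifted_legendre n u / growth u ^ (2 * n)) \<le> sqrt n * (1 / (2 * pi) * (sqrt pi / sqrt (d * n)))"
    by (intro mult_left_mono) auto
  also have "\<dots> = 1 / (2 * pi) * (sqrt pi / sqrt d)"
    using n d by (simp add: real_sqrt_mult)
  finally show ?thesis by (simp add: d_def)
qed

lemma one_plus_not_nonpos:
  fixes u :: complex
  assumes "u \<notin> \<real>\<^sub>\<le>\<^sub>0"
  shows "1 + u \<notin> \<real>\<^sub>\<le>\<^sub>0"
  using assms by (simp add: complex_nonpos_Reals_iff)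

lemma isCont_growth:
  assumes "u \<notin> \<real>\<^sub>\<le>\<^sub>0"
  shows "isCont growth u"
proof -
  have "isCont (\<lambda>u. csqrt (1 + u)) u"
    by (rule isCont_o2[where f = "\<lambda>u. 1 + u" and g = csqrt])
       (auto intro!: continuous_at_csqrt one_plus_not_nonpos assms)
  thus ?thesis
    unfolding growth_def[abs_def] using continuous_at_csqrt[OF assms] by (rule continuous_add[rotated])
qed

lemma isCont_curvature:
  assumes "u \<notin> \<real>\<^sub>\<le>\<^sub>0"
  shows "isCont curvature u"
  unfolding curvature_altdef[abs_def]
  by (intro continuous_divide continuous_diff continuous_power continuous_const isCont_growth assms)
     (simp_all add: growth_nonzero)

text \<open>
  The Laplace--Heine asymptotics, along sequences \<open>U n\<close> that converge to a point off the cut: this is the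
  form in which the rescaled integral over the circle consumes it.
\<close>
lemma shifted_legendre_asymptotic:
  assumes U: "U \<longlonglongrightarrow> u" and u: "u \<notin> \<real>\<^sub>\<le>\<^sub>0"
  shows "(\<lambda>n. sqrt n * (shifted_legendre n (U n) / growth (U n) ^ (2 * n)))
     \<longlonglongrightarrow> 1 / (2 * pi) * (of_real (sqrt pi) / csqrt (curvature u / 2))"
proof -
  define \<mu> where "\<mu> = (1 + norm (growth u)) / 2"
  define d where "d = (1 - 1 / \<mu> ^ 4) / pi\<^sup>2"
  have \<mu>: "1 < \<mu>" "\<mu> < norm (growth u)" using norm_growth_gt_1[OF u] by (auto simp: \<mu>_def)
  have d: "d > 0" using one_div_power4_less[OF \<mu>(1)] by (simp add: d_def)
  have "(\<lambda>n. norm (growth (U n))) \<longlonglongrightarrow> norm (growth u)"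
    by (intro tendsto_norm isCont_tendsto_compose[OF isCont_growth U] u)
  hence ev: "\<forall>\<^sub>F n in sequentially. norm (growth (U n)) > \<mu>"
    using \<mu>(2) by (rule order_tendstoD)
  define f where "f = (\<lambda>n t. (1 - curvature (U n) * (1 - of_real (cos t))) ^ n)"
  have "(\<lambda>n. sqrt (real n) * integral {-pi..pi} (f n)) \<longlonglongrightarrow> 1 * (of_real (sqrt pi) / csqrt (curvature u / 2))"
  proof (rule laplace_method[OF d])
    show "Re (curvature u / 2) > 0" using Re_curvature_pos[OF u] by simp
    show "continuous_on {-pi..pi} (f n)" for n
      unfolding f_def by (rule continuous_laplace_integrand)
    show "\<forall>\<^sub>F n in sequentially. \<forall>t\<in>{-pi..pi}. norm (f n t) \<le> 1 * exp (- d * real n * t\<^sup>2)"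
      using ev
    proof (eventually_elim, intro ballI)
      fix n t assume n: "norm (growth (U n)) > \<mu>" and t: "t \<in> {-pi..pi}"
      show "norm (f n t) \<le> 1 * exp (- d * real n * t\<^sup>2)"
        using norm_laplace_integrand_power_le[of t \<mu> "U n" n] t n \<mu> by (auto simp: d_def f_def)
    qed
    fix s :: real
    have "(\<lambda>n. real n * (1 - cos (s / sqrt (real n)))) \<longlonglongrightarrow> s * s / 2"
      by real_asymp
    hence "(\<lambda>n. - curvature (U n) * of_real (real n * (1 - cos (s / sqrt (real n))))) \<longlonglongrightarrow> - curvature u * of_real (s * s / 2)"
      by (intro tendsto_mult tendsto_minus tendsto_of_real isCont_tendsto_compose[OF isCont_curvature U] u)
    hence "(\<lambda>n. of_nat n * ((1 - curvature (U n) * (1 - of_real (cos (s / sqrt (real n))))) - 1)) \<longlonglongrightarrow> - (curvature u / 2) * of_real s ^ 2"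
      by (simp add: algebra_simps power2_eq_square)
    from power_tendsto_exp[OF this]
    show "(\<lambda>n. f n (s / sqrt (real n))) \<longlonglongrightarrow> 1 * exp (- (curvature u / 2) * (of_real s)\<^sup>2)"
      unfolding f_def by simp
  qed simp
  hence "(\<lambda>n. 1 / (2 * pi) * (sqrt (real n) * integral {-pi..pi} (f n))) \<longlonglongrightarrow> 1 / (2 * pi) * (1 * (of_real (sqrt pi) / csqrt (curvature u / 2)))"
    by (rule tendsto_mult[OF tendsto_const])
  thus ?thesis unfolding shifted_legendre_normalised f_def by (simp add: mult_ac)
qed

section \<open>The saddle point on the circle\<close>

text \<open>
  The circle through the saddle points \<open>\<plusminus> \<i> r\<close>, parametrised so that the saddle \<open>\<i> r\<close> is at \<open>t = 0\<close>; the points of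
  parameters \<open>t\<close> and \<open>-t\<close> have the product \<open>- (r\<^sup>2)\<close>.
\<close>
definition saddle_circle :: "real \<Rightarrow> real \<Rightarrow> complex" where
  "saddle_circle r t = \<i> * of_real r * cis t"

lemma norm_one_plus_saddle_circle:
  "(norm (1 + saddle_circle r t))\<^sup>2 = 1 + r\<^sup>2 - 2 * r * sin t"
  unfolding cmod_power2 saddle_circle_def
  by (simp add: power2_eq_square algebra_simps) (metis distrib_left mult.commute mult.right_neutral power2_eq_square sin_cos_squared_add3)

lemma saddle_circle_not_nonpos:
  assumes "r > 0" "\<bar>t\<bar> < pi / 2"
  shows "saddle_circle r t \<notin> \<real>\<^sub>\<le>\<^sub>0"
proof -
  have "cos t > 0" using assms by (intro cos_gt_zero_pi) auto
  thus ?thesis using assms by (simp add: saddle_circle_def complex_nonpos_Reals_iff)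
qed

text \<open>
  The squares of the two distances have the constant sum \<open>2 (1 + r\<^sup>2)\<close>, so the sum of the distances is largest when
  they agree, which happens for \<open>sin t = 0\<close>; the loss is quadratic in \<open>sin t\<close>.
\<close>
lemma sum_norm_one_plus_saddle_circle_le:
  assumes "r > 0"
  shows "norm (1 + saddle_circle r t) + norm (1 + saddle_circle r (-t)) \<le> 2 * sqrt (1 + r\<^sup>2) - r\<^sup>2 / sqrt (1 + r\<^sup>2) ^ 3 * (sin t)\<^sup>2"
proof -
  define R where "R = sqrt (1 + r\<^sup>2)"
  have R: "R > 0" "R\<^sup>2 = 1 + r\<^sup>2" "R \<ge> 1" using assms by (auto simp: R_def add_pos_nonneg)
  define y y' where "y = norm (1 + saddle_circle r t)" and "y' = norm (1 + saddle_circle r (-t))"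
  have y: "y\<^sup>2 = R\<^sup>2 - 2 * r * sin t" "y'\<^sup>2 = R\<^sup>2 + 2 * r * sin t"
    unfolding y_def y'_def norm_one_plus_saddle_circle by (simp_all add: R)
  define e where "e = r\<^sup>2 / R ^ 3 * (sin t)\<^sup>2"
  have eR: "2 * r\<^sup>2 * (sin t)\<^sup>2 / R\<^sup>2 = 2 * R * e"
    using R(1) by (simp add: e_def field_simps power2_eq_square power3_eq_cube)
  have e: "e \<ge> 0" "e \<le> R"
  proof -
    show "e \<ge> 0" using R(1) by (simp add: e_def)
    have "r\<^sup>2 * (sin t)\<^sup>2 \<le> R\<^sup>2 * 1"
      using R(2) by (intro mult_mono) (auto simp: abs_square_le_1)
    also have "\<dots> * 1 \<le> R\<^sup>2 * R\<^sup>2" using R by (intro mult_mono) auto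
    finally show "e \<le> R" using R(1)
      by (simp add: e_def field_simps power2_eq_square power3_eq_cube)
  qed
  have "y * y' \<le> R\<^sup>2 - 2 * r\<^sup>2 * (sin t)\<^sup>2 / R\<^sup>2"
  proof (rule power2_le_imp_le)
    have "(y * y')\<^sup>2 = (R\<^sup>2)\<^sup>2 - 4 * r\<^sup>2 * (sin t)\<^sup>2"
      unfolding power_mult_distrib y by (simp add: algebra_simps power2_eq_square)
    also have "\<dots> = (R\<^sup>2)\<^sup>2 - 2 * R\<^sup>2 * (2 * R * e)"
      using R(1) unfolding eR[symmetric] by simp
    also have "\<dots> \<le> (R\<^sup>2 - 2 * R * e)\<^sup>2" by (simp add: power2_diff)
    finally show "(y * y')\<^sup>2 \<le> (R\<^sup>2 - 2 * r\<^sup>2 * (sin t)\<^sup>2 / R\<^sup>2)\<^sup>2" by (simp add: eR)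
    have "2 * r\<^sup>2 * (sin t)\<^sup>2 \<le> (R\<^sup>2)\<^sup>2"
    proof -
      have "2 * r \<le> R\<^sup>2" using R(2) sum_squares_ge_zero[of "r - 1" 0] by (simp add: power2_eq_square algebra_simps)
      hence "(2 * r)\<^sup>2 \<le> (R\<^sup>2)\<^sup>2" using assms by (intro power_mono) auto
      moreover have "2 * r\<^sup>2 * (sin t)\<^sup>2 \<le> (2 * r)\<^sup>2 * 1" 
        by (intro mult_mono) (auto simp: abs_square_le_1 power_mult_distrib)
      ultimately show ?thesis by simp
    qed
    thus "0 \<le> R\<^sup>2 - 2 * r\<^sup>2 * (sin t)\<^sup>2 / R\<^sup>2"
      using R(1) by (simp add: field_simps power2_eq_square)
  qed
  hence "(y + y')\<^sup>2 \<le> 4 * R\<^sup>2 - 4 * R * e"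
    using y unfolding eR power2_sum by simp
  also have "\<dots> \<le> (2 * R - e)\<^sup>2" by (simp add: power2_diff power_mult_distrib)
  finally have "y + y' \<le> 2 * R - e"
    using e by (rule_tac power2_le_imp_le) auto
  thus ?thesis by (simp add: y_def y'_def e_def R_def)
qed

text \<open>
  On \<open>[1, \<infinity>)\<close> the function \<open>x + 1 / x\<close> is increasing with slope at most \<open>1\<close>.
\<close>
lemma add_inverse_le_imp_diff:
  fixes x y e :: real
  assumes "x \<ge> 1" "y > 1" "e \<ge> 0" "x + 1 / x \<le> y + 1 / y - e"
  shows "x \<le> y - e"
proof -
  define q where "q = 1 - 1 / (x * y)"
  have "1 * 1 < x * y" using assms by (intro mult_le_less_imp_less) auto
  hence q: "0 < q" "q \<le> 1" by (auto simp: q_def)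
  have "(y - x) * q = (y + 1 / y) - (x + 1 / x)"
    using assms by (simp add: q_def field_simps)
  hence *: "(y - x) * q \<ge> e" using assms by linarith
  hence "(y - x) * q \<ge> 0" using assms by linarith
  hence "y - x \<ge> 0" using q by (simp add: zero_le_mult_iff)
  hence "(y - x) * q \<le> (y - x) * 1" using q by (intro mult_left_mono) auto
  with * have "e \<le> y - x" by simp
  thus ?thesis by simp
qed

text \<open>
  The product of the two growth rates has its maximum over the half circle at the saddle, with Gaussian decay on
  either side. The arithmetic-geometric mean inequality bounds \<open>m + 1 / m\<close>, for \<open>m\<close> the product, by the mean of the
  corresponding quantities of the two factors, and these are sums of distances by the ellipse identity.
\<close>
lemma norm_growth_saddle_circle_mult_le:
  assumes r: "r > 0" and t: "\<bar>t\<bar> \<le> pi / 2"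
  defines "M0 \<equiv> (norm (growth (saddle_circle r 0)))\<^sup>2"
  defines "d \<equiv> 4 * r\<^sup>2 / (pi\<^sup>2 * sqrt (1 + r\<^sup>2) ^ 3 * M0)"
  shows "norm (growth (saddle_circle r t)) * norm (growth (saddle_circle r (-t))) \<le> M0 * exp (- d * t\<^sup>2)"
proof -
  define x y where "x = norm (growth (saddle_circle r t))" and "y = norm (growth (saddle_circle r (-t)))"
  define e where "e = r\<^sup>2 / sqrt (1 + r\<^sup>2) ^ 3 * (sin t)\<^sup>2"
  have R: "sqrt (1 + r\<^sup>2) > 0" by (simp add: add_pos_nonneg)
  have e: "e \<ge> 0" by (simp add: e_def)
  have xy: "x \<ge> 1" "y \<ge> 1" by (auto simp: x_def y_def norm_growth_ge_1)
  have M0: "M0 > 1"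
    unfolding M0_def using r by (intro one_less_power norm_growth_gt_1 saddle_circle_not_nonpos) auto
  have "norm (1 + saddle_circle r 0) = sqrt (1 + r\<^sup>2)"
    using norm_one_plus_saddle_circle[of r 0] by (simp add: real_sqrt_unique)
  hence M0_eq: "M0 + 1 / M0 = 2 * (r + sqrt (1 + r\<^sup>2))"
    unfolding M0_def norm_growth_joukowsky using r by (simp add: saddle_circle_def norm_mult)
  have "x * y + 1 / (x * y) \<le> M0 + 1 / M0 - e"
  proof -
    have "2 * (x * y) \<le> x\<^sup>2 + y\<^sup>2"
      using sum_squares_bound[of x y] by (simp add: mult.assoc)
    moreover have "2 * (1 / (x * y)) \<le> 1 / x\<^sup>2 + 1 / y\<^sup>2"
      using sum_squares_bound[of "1 / x" "1 / y"] by (simp add: power_divide)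
    ultimately have "2 * (x * y + 1 / (x * y)) \<le> (x\<^sup>2 + 1 / x\<^sup>2) + (y\<^sup>2 + 1 / y\<^sup>2)"
      by argo
    also have "\<dots> = 2 * (2 * r + (norm (1 + saddle_circle r t) + norm (1 + saddle_circle r (-t))))"
      unfolding x_def y_def norm_growth_joukowsky using r by (simp add: saddle_circle_def norm_mult)
    also have "\<dots> \<le> 2 * (2 * r + (2 * sqrt (1 + r\<^sup>2) - e))"
      using sum_norm_one_plus_saddle_circle_le[OF r, of t] by (simp add: e_def)
    finally show ?thesis using M0_eq by simp
  qed
  moreover have "1 \<le> x * y" using mult_mono[OF xy] xy by simp
  ultimately have "x * y \<le> M0 - e"
    by (intro add_inverse_le_imp_diff[OF _ M0 e])
  also have "\<dots> = M0 * (1 + (- (e / M0)))" using M0 by (simp add: field_simps)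
  also have "\<dots> \<le> M0 * exp (- (e / M0))"
    using M0 by (intro mult_left_mono exp_ge_add_one_self) auto
  also have "\<dots> \<le> M0 * exp (- (d * t\<^sup>2))"
  proof -
    have "d * t\<^sup>2 = r\<^sup>2 / sqrt (1 + r\<^sup>2) ^ 3 / M0 * (2 / pi * t)\<^sup>2"
      by (simp add: d_def power_divide power_mult_distrib mult_ac)
    also have "\<dots> \<le> r\<^sup>2 / sqrt (1 + r\<^sup>2) ^ 3 / M0 * (sin t)\<^sup>2"
      using M0 R by (intro mult_left_mono jordan_inequality t) auto
    also have "\<dots> = e / M0" by (simp add: e_def)
    finally show ?thesis using M0 by simp
  qed
  finally show ?thesis by (simp add: x_def y_def)
qed

text \<open>
  Multiplying out, \<open>growth (U n) * growth (V n)\<close> splits into \<open>K n + D n + E n\<close> with \<open>K n\<close> the product of the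
  roots of \<open>U n\<close> and \<open>V n\<close>, \<open>D n\<close> that of the roots of \<open>1 + U n\<close> and \<open>1 + V n\<close>, and \<open>E n\<close> the mixed terms. Here
  \<open>K n\<close> is eventually constant, \<open>(D n)\<^sup>2\<close> is affine in \<open>\<epsilon> n = 1 - cos (T n)\<close>, and \<open>(E n)\<^sup>2\<close> is affine in \<open>\<epsilon> n\<close> and \<open>D n\<close>. Hence the second
  order behaviour follows from the continuity of the square roots alone, via
  \<open>D - D\<^sub>0 = (D\<^sup>2 - D\<^sub>0\<^sup>2) / (D + D\<^sub>0)\<close>, and no derivative of a branch has to be computed.
\<close>
lemma growth_saddle_circle_second_order:
  assumes r: "r > 0"
  defines "a \<equiv> csqrt (saddle_circle r 0)" and "b \<equiv> csqrt (1 + saddle_circle r 0)"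
  shows "(\<lambda>n. of_nat n * (growth (saddle_circle r (s / sqrt n)) * growth (saddle_circle r (-(s / sqrt n))) / (growth (saddle_circle r 0))\<^sup>2 - 1))
     \<longlonglongrightarrow> - (a / (4 * b ^ 3)) * of_real s ^ 2"
proof -
  define u where "u = saddle_circle r 0"
  have u: "u \<notin> \<real>\<^sub>\<le>\<^sub>0" unfolding u_def using r by (intro saddle_circle_not_nonpos) auto
  have ab2: "a\<^sup>2 = u" "b\<^sup>2 = 1 + u" by (simp_all add: a_def b_def u_def)
  have g: "growth u = a + b" by (simp add: growth_def a_def b_def u_def)
  have nz: "a \<noteq> 0" "b \<noteq> 0" "a + b \<noteq> 0"
    using u one_plus_not_nonpos[OF u] growth_nonzero[of u] g by (auto simp: a_def b_def simp flip: u_def)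
  define T where "T = (\<lambda>n::nat. s / sqrt n)"
  have T: "T \<longlonglongrightarrow> 0" unfolding T_def by real_asymp
  have arc_lim: "(\<lambda>n. saddle_circle r (c * T n)) \<longlonglongrightarrow> u" for c
  proof -
    have "(\<lambda>n. saddle_circle r (c * T n)) \<longlonglongrightarrow> saddle_circle r (c * 0)"
      unfolding saddle_circle_def by (intro tendsto_intros T)
    thus ?thesis by (simp add: u_def)
  qed
  define U where "U = (\<lambda>n. saddle_circle r (T n))"
  define V where "V = (\<lambda>n. saddle_circle r (- T n))"
  have UV: "U \<longlonglongrightarrow> u" "V \<longlonglongrightarrow> u"
    using arc_lim[of 1] arc_lim[of "-1"] by (simp_all add: U_def V_def)
  define a1 b1 a2 b2 where "a1 = (\<lambda>n. csqrt (U n))" and "b1 = (\<lambda>n. csqrt (1 + U n))"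
    and "a2 = (\<lambda>n. csqrt (V n))" and "b2 = (\<lambda>n. csqrt (1 + V n))"
  have lim: "a1 \<longlonglongrightarrow> a" "a2 \<longlonglongrightarrow> a" "b1 \<longlonglongrightarrow> b" "b2 \<longlonglongrightarrow> b"
    unfolding a1_def a2_def b1_def b2_def a_def b_def u_def[symmetric]
    by (intro isCont_tendsto_compose[OF continuous_at_csqrt] tendsto_add tendsto_const UV u one_plus_not_nonpos)+
  define \<epsilon> where "\<epsilon> = (\<lambda>n. 1 - cos (T n))"
  have "(\<lambda>n. real n * \<epsilon> n) \<longlonglongrightarrow> s * s / 2"
    unfolding \<epsilon>_def T_def by real_asymp
  hence eps: "(\<lambda>n. of_nat n * complex_of_real (\<epsilon> n)) \<longlonglongrightarrow> of_real s ^ 2 / 2"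
    using tendsto_of_real[of "\<lambda>n. real n * \<epsilon> n" "s * s / 2" sequentially, where 'a = complex] by (simp add: power2_eq_square)
  have UVmul: "U n * V n = u\<^sup>2" for n
    by (simp add: U_def V_def saddle_circle_def u_def cis_mult power2_eq_square)
  have UVadd: "U n + V n = 2 * u * (1 - of_real (\<epsilon> n))" for n
  proof -
    have "cis t + cis (-t) = 2 * of_real (cos t)" for t by (simp add: complex_eq_iff)
    thus ?thesis by (simp add: U_def V_def saddle_circle_def u_def \<epsilon>_def flip: distrib_left)
  qed
  define D where "D = (\<lambda>n. b1 n * b2 n)"
  define E where "E = (\<lambda>n. a1 n * b2 n + a2 n * b1 n)"
  define K where "K = (\<lambda>n. a1 n * a2 n)"
  have limD: "D \<longlonglongrightarrow> b\<^sup>2" unfolding D_def power2_eq_square by (intro tendsto_mult lim)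
  have limE: "E \<longlonglongrightarrow> 2 * a * b"
  proof -
    have "E \<longlonglongrightarrow> a * b + a * b" unfolding E_def by (intro tendsto_intros lim)
    moreover have "a * b + a * b = 2 * a * b" by simp
    ultimately show ?thesis by (simp only:)
  qed
  have limK: "K \<longlonglongrightarrow> u" unfolding K_def ab2(1)[symmetric] power2_eq_square by (intro tendsto_mult lim)
  have sq: "(a1 n)\<^sup>2 = U n" "(a2 n)\<^sup>2 = V n" "(b1 n)\<^sup>2 = 1 + U n" "(b2 n)\<^sup>2 = 1 + V n" for n
    by (simp_all add: a1_def a2_def b1_def b2_def)
  \<comment> \<open>Squaring determines \<open>K n\<close> up to the sign, which continuity at the saddle then fixes.\<close>
  have K: "\<forall>\<^sub>F n in sequentially. K n = u"
  proof -
    have "\<forall>\<^sub>F n in sequentially. K n \<noteq> - u"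
      using tendsto_imp_eventually_ne[OF limK, of "-u"] nz(1) ab2(1) by auto
    thus ?thesis
    proof eventually_elim
      case (elim n)
      have "(K n)\<^sup>2 = u\<^sup>2" unfolding K_def power_mult_distrib sq UVmul ..
      with elim show ?case by (auto simp: power2_eq_iff)
    qed
  qed
  have D2: "(D n)\<^sup>2 = (1 + u)\<^sup>2 - 2 * u * of_real (\<epsilon> n)" for n
  proof -
    have "(D n)\<^sup>2 = 1 + (U n + V n) + U n * V n"
      unfolding D_def power_mult_distrib sq by (simp add: algebra_simps)
    thus ?thesis unfolding UVadd UVmul by (simp add: algebra_simps power2_eq_square)
  qed
  have nD: "(\<lambda>n. of_nat n * (D n - b\<^sup>2)) \<longlonglongrightarrow> - 2 * u * (of_real s ^ 2 / 2) / (b\<^sup>2 + b\<^sup>2)"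
  proof (rule Lim_transform_eventually)
    show "(\<lambda>n. - 2 * u * (of_nat n * of_real (\<epsilon> n)) / (D n + b\<^sup>2)) \<longlonglongrightarrow> - 2 * u * (of_real s ^ 2 / 2) / (b\<^sup>2 + b\<^sup>2)"
      using nz by (intro tendsto_intros eps limD) auto
    have "\<forall>\<^sub>F n in sequentially. D n \<noteq> - (b\<^sup>2)"
      using tendsto_imp_eventually_ne[OF limD, of "-(b\<^sup>2)"] nz by auto
    thus "\<forall>\<^sub>F n in sequentially. - 2 * u * (of_nat n * of_real (\<epsilon> n)) / (D n + b\<^sup>2) = of_nat n * (D n - b\<^sup>2)"
    proof eventually_elim
      case (elim n)
      have "(D n - b\<^sup>2) * (D n + b\<^sup>2) = - 2 * u * of_real (\<epsilon> n)"
        using D2[of n] unfolding ab2(2) by (simp add: algebra_simps power2_eq_square)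
      hence "of_nat n * (D n - b\<^sup>2) * (D n + b\<^sup>2) = - 2 * u * (of_nat n * of_real (\<epsilon> n))"
        by (simp only: mult_ac)
      moreover have "D n + b\<^sup>2 \<noteq> 0" using elim by (simp add: add_eq_0_iff2)
      ultimately show ?case by (metis nonzero_mult_div_cancel_right)
    qed
  qed
  have E2: "\<forall>\<^sub>F n in sequentially. (E n)\<^sup>2 = 2 * u * (1 - of_real (\<epsilon> n)) + 2 * u\<^sup>2 + 2 * u * D n"
    using K
  proof eventually_elim
    case (elim n)
    have "(E n)\<^sup>2 = (a1 n)\<^sup>2 * (b2 n)\<^sup>2 + (a2 n)\<^sup>2 * (b1 n)\<^sup>2 + 2 * K n * D n"
      unfolding E_def K_def D_def by algebra
    also have "\<dots> = (U n + V n) + 2 * (U n * V n) + 2 * u * D n"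
      unfolding sq elim by (simp add: algebra_simps)
    finally show ?case unfolding UVadd UVmul .
  qed
  define dD where "dD = - 2 * u * (of_real s ^ 2 / 2) / (b\<^sup>2 + b\<^sup>2)"
  have nE: "(\<lambda>n. of_nat n * (E n - 2 * a * b)) \<longlonglongrightarrow> (- 2 * u * (of_real s ^ 2 / 2) + 2 * u * dD) / (2 * a * b + 2 * a * b)"
  proof (rule Lim_transform_eventually)
    show "(\<lambda>n. (- 2 * u * (of_nat n * of_real (\<epsilon> n)) + 2 * u * (of_nat n * (D n - b\<^sup>2))) / (E n + 2 * a * b))
        \<longlonglongrightarrow> (- 2 * u * (of_real s ^ 2 / 2) + 2 * u * dD) / (2 * a * b + 2 * a * b)"
      using nz nD unfolding dD_def by (intro tendsto_divide tendsto_add tendsto_mult tendsto_const eps limE) auto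
    have "\<forall>\<^sub>F n in sequentially. E n \<noteq> - (2 * a * b)"
      using tendsto_imp_eventually_ne[OF limE, of "-(2 * a * b)"] nz by auto
    thus "\<forall>\<^sub>F n in sequentially. (- 2 * u * (of_nat n * of_real (\<epsilon> n)) + 2 * u * (of_nat n * (D n - b\<^sup>2))) / (E n + 2 * a * b)
       = of_nat n * (E n - 2 * a * b)"
      using E2
    proof eventually_elim
      case (elim n)
      have "(E n - 2 * a * b) * (E n + 2 * a * b) = (E n)\<^sup>2 - 4 * a\<^sup>2 * b\<^sup>2" by algebra
      also have "\<dots> = - 2 * u * of_real (\<epsilon> n) + 2 * u * (D n - b\<^sup>2)"
        unfolding elim(2) ab2 by (simp add: algebra_simps power2_eq_square)
      finally have "of_nat n * (E n - 2 * a * b) * (E n + 2 * a * b)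
          = - 2 * u * (of_nat n * of_real (\<epsilon> n)) + 2 * u * (of_nat n * (D n - b\<^sup>2))"
        by algebra
      moreover have "E n + 2 * a * b \<noteq> 0" using elim(1) by (simp add: add_eq_0_iff2)
      ultimately show ?case by (metis nonzero_mult_div_cancel_right)
    qed
  qed
  define dE where "dE = (- 2 * u * (of_real s ^ 2 / 2) + 2 * u * dD) / (2 * a * b + 2 * a * b)"
  have L: "(\<lambda>n. (of_nat n * (D n - b\<^sup>2) + of_nat n * (E n - 2 * a * b)) / (growth u)\<^sup>2) \<longlonglongrightarrow> (dD + dE) / (growth u)\<^sup>2"
    using nD nE growth_nonzero[of u] unfolding dE_def dD_def by (intro tendsto_divide tendsto_add tendsto_const) auto
  have ev: "\<forall>\<^sub>F n in sequentially. (of_nat n * (D n - b\<^sup>2) + of_nat n * (E n - 2 * a * b)) / (growth u)\<^sup>2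
      = of_nat n * (growth (U n) * growth (V n) / (growth u)\<^sup>2 - 1)"
    using K
  proof eventually_elim
    case (elim n)
    have "growth (U n) * growth (V n) = K n + D n + E n"
      by (simp add: growth_def K_def D_def E_def a1_def a2_def b1_def b2_def algebra_simps)
    moreover have "(growth u)\<^sup>2 = u + b\<^sup>2 + 2 * a * b"
      by (simp add: g power2_sum ab2(1))
    ultimately have "(D n - b\<^sup>2) + (E n - 2 * a * b) = growth (U n) * growth (V n) - (growth u)\<^sup>2"
      using elim by simp
    hence "of_nat n * (D n - b\<^sup>2) + of_nat n * (E n - 2 * a * b) = of_nat n * (growth (U n) * growth (V n) - (growth u)\<^sup>2)"
      by (simp flip: distrib_left)
    thus ?case using growth_nonzero[of u] by (simp add: diff_divide_distrib right_diff_distrib)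
  qed
  have val: "(dD + dE) / (growth u)\<^sup>2 = - (a / (4 * b ^ 3)) * of_real s ^ 2"
  proof -
    define w where "w = complex_of_real s ^ 2"
    have dD: "dD * (2 * b\<^sup>2) = - u * w" using nz by (simp add: dD_def w_def)
    have dE: "dE * (4 * a * b) = - u * w + 2 * u * dD"
    proof -
      have "2 * a * b + 2 * a * b = 4 * a * b" by simp
      thus ?thesis using nz unfolding dE_def w_def by simp
    qed
    have "(dD + dE) * (4 * b ^ 3) * a = (- (a + b)\<^sup>2 * a * w) * a"
    proof -
      have "dD * (2 * b\<^sup>2) = - (a * a) * w" "dE * (4 * a * b) = - (a * a) * w + 2 * (a * a) * dD"
        using dD dE ab2(1) by (simp_all add: power2_eq_square)
      thus ?thesis by algebra
    qed
    hence "(dD + dE) * (4 * b ^ 3) = - (a + b)\<^sup>2 * a * w"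
      unfolding mult_right_cancel[OF nz(1)] .
    hence "dD + dE = (a + b)\<^sup>2 * (- (a / (4 * b ^ 3)) * w)"
      using nz by (simp add: field_simps)
    thus ?thesis unfolding g using nz by (simp add: w_def)
  qed
  from Lim_transform_eventually[OF L ev]
  have "(\<lambda>n. of_nat n * (growth (U n) * growth (V n) / (growth u)\<^sup>2 - 1)) \<longlonglongrightarrow> - (a / (4 * b ^ 3)) * of_real s ^ 2"
    unfolding val .
  thus ?thesis by (simp add: U_def V_def T_def u_def)
qed

section \<open>Asymptotics of the half-circle integral\<close>

lemma isCont_saddle_circle: "isCont (saddle_circle r) t"
  unfolding saddle_circle_def isCont_def by (intro tendsto_intros)

lemma continuous_on_shifted_legendre_saddle_circle: "continuous_on A (\<lambda>t. shifted_legendre n (saddle_circle r t))"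
  unfolding shifted_legendre_def saddle_circle_def by (intro continuous_intros)

text \<open>
  Laplace's method for the integrand \<open>f n t\<close>, which is \<open>n\<close> times the product of the two normalised Legendre polynomials
  \<open>R n\<close> and the power \<open>Q t ^ (2 * n)\<close> of the normalised product of growth rates. The former, with the factor \<open>n\<close>, tends to the square of the constant
  of the Laplace--Heine asymptotics, the latter to a Gaussian.
\<close>
lemma half_circle_integral_asymptotic:
  fixes r :: real and f :: "nat \<Rightarrow> real \<Rightarrow> complex"
  assumes r: "r > 0"
  defines "u \<equiv> saddle_circle r 0"
  defines "k \<equiv> csqrt u / (2 * csqrt (1 + u) ^ 3)"
  defines "f \<equiv> \<lambda>n t. of_nat n * (shifted_legendre n (saddle_circle r t) * shifted_legendre n (saddle_circle r (-t))) / growth u ^ (4 * n)"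
  shows "(\<lambda>n. sqrt (real n) * integral {-(pi/2)..pi/2} (f n))
     \<longlonglongrightarrow> 1 / (2 * pi * curvature u) * (of_real (sqrt pi) / csqrt k)"
proof -
  have u: "u \<notin> \<real>\<^sub>\<le>\<^sub>0" unfolding u_def using r by (intro saddle_circle_not_nonpos) auto
  define R where "R = (\<lambda>n v. shifted_legendre n v / growth v ^ (2 * n))"
  define Q where "Q = (\<lambda>t. growth (saddle_circle r t) * growth (saddle_circle r (-t)) / (growth u)\<^sup>2)"
  have f_eq: "f n t = of_nat n * (R n (saddle_circle r t) * R n (saddle_circle r (-t))) * Q t ^ (2 * n)" for n t
  proof -
    have "(growth u)\<^sup>2 ^ (2 * n) = growth u ^ (4 * n)" by (simp flip: power_mult)
    thus ?thesis
      using growth_nonzero[of "saddle_circle r t"] growth_nonzero[of "saddle_circle r (-t)"]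
      by (simp add: f_def R_def Q_def power_divide power_mult_distrib)
  qed
  define M0 where "M0 = (norm (growth u))\<^sup>2"
  have M0: "M0 > 1" unfolding M0_def by (intro one_less_power norm_growth_gt_1 u) auto
  define d where "d = 4 * r\<^sup>2 / (pi\<^sup>2 * sqrt (1 + r\<^sup>2) ^ 3 * M0)"
  have d: "d > 0" unfolding d_def using M0 r by (intro divide_pos_pos mult_pos_pos zero_less_power) (auto simp: add_pos_nonneg)
  have Q_le: "norm (Q t) \<le> exp (- d * t\<^sup>2)" if "\<bar>t\<bar> \<le> pi/2" for t
    using norm_growth_saddle_circle_mult_le[OF r that] M0
    by (simp add: Q_def norm_divide norm_mult norm_power d_def divide_le_eq mult.commute flip: u_def M0_def)
  have Q_pow_le: "norm (Q t ^ (2 * n)) \<le> exp (- (2 * d * n * t\<^sup>2))" if "\<bar>t\<bar> \<le> pi/2" for t n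
  proof -
    have "norm (Q t) ^ (2 * n) \<le> exp (- d * t\<^sup>2) ^ (2 * n)"
      by (intro power_mono Q_le that) auto
    also have "\<dots> = exp (- (2 * d * n * t\<^sup>2))"
      by (simp add: mult_ac flip: exp_of_nat_mult)
    finally show ?thesis by (simp add: norm_power)
  qed
  have Q_lim: "(\<lambda>n. Q (s / sqrt n) ^ (2 * n)) \<longlonglongrightarrow> exp (- k * of_real s ^ 2)" for s
  proof -
    define k' where "k' = csqrt u / (4 * csqrt (1 + u) ^ 3)"
    have "(\<lambda>n. of_nat n * (Q (s / sqrt n) - 1)) \<longlonglongrightarrow> - k' * of_real s ^ 2"
      using growth_saddle_circle_second_order[OF r, of s] by (simp add: Q_def k'_def u_def)
    hence "(\<lambda>n. (Q (s / sqrt n) ^ n) ^ 2) \<longlonglongrightarrow> exp (- k' * of_real s ^ 2) ^ 2"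
      by (intro tendsto_power power_tendsto_exp)
    also have "exp (- k' * of_real s ^ 2) ^ 2 = exp (- k * of_real s ^ 2)"
      by (simp add: k_def k'_def field_simps flip: exp_of_nat_mult)
    finally show ?thesis by (simp add: mult.commute flip: power_mult)
  qed
  have k: "Re k > 0"
  proof -
    \<comment> \<open>The Gaussian bound for \<open>Q\<close> passes to the limit.\<close>
    have "norm (exp (- k * of_real 1 ^ 2)) \<le> exp (- 2 * d)"
    proof (rule tendsto_upperbound[OF tendsto_norm[OF Q_lim]])
      have "(\<lambda>n. 1 / sqrt (real n)) \<longlonglongrightarrow> 0" by real_asymp
      hence "\<forall>\<^sub>F n in sequentially. 1 / sqrt (real n) < pi / 2"
        by (rule order_tendstoD) simp
      thus "\<forall>\<^sub>F n in sequentially. norm (Q (1 / sqrt n) ^ (2 * n)) \<le> exp (- 2 * d)"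
        using eventually_gt_at_top[of 0]
      proof eventually_elim
        case (elim n)
        have "real n * (1 / sqrt (real n))\<^sup>2 = 1" using elim by (simp add: power_divide)
        thus ?case using Q_pow_le[of "1 / sqrt n" n] elim by (simp add: mult.assoc)
      qed
    qed simp
    thus ?thesis using d by simp
  qed
  define \<mu> where "\<mu> = (1 + norm (growth u)) / 2"
  have \<mu>: "1 < \<mu>" "\<mu> < norm (growth u)" using norm_growth_gt_1[OF u] by (auto simp: \<mu>_def)
  obtain h where h: "h > 0" "\<And>t. \<bar>t\<bar> < h \<Longrightarrow> norm (growth (saddle_circle r t)) > \<mu>"
  proof -
    have "isCont (\<lambda>t. norm (growth (saddle_circle r t))) 0"
      by (intro continuous_norm isCont_o2[OF isCont_saddle_circle isCont_growth]) (use u in \<open>simp add: u_def\<close>)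
    hence "((\<lambda>t. norm (growth (saddle_circle r t))) \<longlongrightarrow> norm (growth u)) (nhds 0)"
      unfolding isCont_def u_def
      by (rule tendsto_at_iff_tendsto_nhds[where g = "\<lambda>t. norm (growth (saddle_circle r t))", THEN iffD1])
    hence "\<forall>\<^sub>F t in nhds 0. norm (growth (saddle_circle r t)) > \<mu>"
      using \<mu>(2) by (rule order_tendstoD)
    thus ?thesis using that by (auto simp: eventually_nhds_metric dist_norm)
  qed
  define K where "K = 1 / (2 * pi) * (sqrt pi / sqrt ((1 - 1 / \<mu> ^ 4) / pi\<^sup>2))"
  define C where "C = K * K + 1 / (d * h\<^sup>2)"
  define A where "A = 1 / (2 * pi) * (of_real (sqrt pi) / csqrt (curvature u / 2))"
  have A: "A * A = 1 / (2 * pi * curvature u)"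
  proof -
    have "complex_of_real (sqrt pi) * of_real (sqrt pi) = of_real pi" by (simp flip: of_real_mult)
    moreover have "csqrt (curvature u / 2) * csqrt (curvature u / 2) = curvature u / 2"
      by (simp flip: power2_eq_square)
    moreover have "(1 / (2 * p) * (v / w)) * (1 / (2 * p) * (v / w)) = 1 / (4 * p * p) * (v * v / (w * w))" for p v w :: complex
      by (simp add: mult_ac)
    ultimately have "A * A = 1 / (4 * of_real pi * of_real pi) * (of_real pi / (curvature u / 2))"
      unfolding A_def of_real_divide of_real_mult of_real_numeral of_real_1 by (simp only:)
    thus ?thesis by simp
  qed
  have "(\<lambda>n. sqrt (real n) * integral {-(pi/2)..pi/2} (f n))
     \<longlonglongrightarrow> (A * A) * (of_real (sqrt pi) / csqrt k)"
  proof (rule laplace_method[OF d k])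
    show "continuous_on {-(pi/2)..pi/2} (f n)" for n
    proof -
      have "continuous_on A (\<lambda>t. shifted_legendre n (saddle_circle r (-t)))" for A
        by (rule continuous_on_compose2[OF continuous_on_shifted_legendre_saddle_circle[of UNIV]]) (auto intro: continuous_intros)
      thus ?thesis unfolding f_def using growth_nonzero[of u]
        by (intro continuous_on_divide continuous_on_mult continuous_on_const continuous_on_shifted_legendre_saddle_circle) auto
    qed
    show "\<forall>\<^sub>F n in sequentially. \<forall>t\<in>{-(pi/2)..pi/2}. norm (f n t) \<le> C * exp (- d * real n * t\<^sup>2)"
      using eventually_gt_at_top[of 0]
    proof (eventually_elim, intro ballI)
      fix n :: nat and t assume n: "n > 0" and t: "t \<in> {-(pi/2)..pi/2}"
      define x where "x = d * real n * t\<^sup>2"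
      have x: "x \<ge> 0" using d by (simp add: x_def)
      define \<rho> where "\<rho> = real n * (norm (R n (saddle_circle r t)) * norm (R n (saddle_circle r (-t))))"
      have f_le: "norm (f n t) \<le> \<rho> * exp (- (2 * x))"
      proof -
        have "norm (f n t) = \<rho> * norm (Q t ^ (2 * n))" by (simp add: f_eq \<rho>_def norm_mult)
        also have "\<dots> \<le> \<rho> * exp (- (2 * d * n * t\<^sup>2))"
          using t by (intro mult_left_mono Q_pow_le) (auto simp: \<rho>_def)
        finally show ?thesis by (simp add: x_def mult.assoc)
      qed
      \<comment> \<open>Near the saddle the two factors \<open>sqrt n\<close> are absorbed by the Legendre polynomials. Away from it the points
        may approach the cut, but there half of the exponential decay compensates the factor \<open>n\<close>.\<close>
      have "\<rho> * exp (- (2 * x)) \<le> C * exp (- x)"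
      proof (cases "\<bar>t\<bar> < h")
        case True
        have R_le: "sqrt n * norm (R n (saddle_circle r t')) \<le> K" if "\<bar>t'\<bar> < h" for t'
          unfolding R_def K_def using h(2)[OF that] \<mu> n
          by (intro norm_shifted_legendre_normalised_le) auto
        have "\<rho> = (sqrt n * norm (R n (saddle_circle r t))) * (sqrt n * norm (R n (saddle_circle r (-t))))"
          by (simp add: \<rho>_def mult_ac flip: real_sqrt_mult)
        also have "\<dots> \<le> K * K"
          using R_le[of t] R_le[of "-t"] True by (intro mult_mono) (auto intro: order_trans[OF _ R_le[of t]])
        also have "\<dots> \<le> C" using d by (simp add: C_def)
        finally have "\<rho> \<le> C" .
        moreover have "\<rho> \<ge> 0" by (simp add: \<rho>_def)
        ultimately show ?thesis using x by (intro mult_mono) auto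
      next
        case False
        have "\<rho> \<le> real n * (1 * 1)"
          unfolding \<rho>_def R_def
          by (intro mult_left_mono mult_mono norm_shifted_legendre_normalised_le_1) auto
        moreover have "real n * (d * h\<^sup>2) \<le> exp x"
        proof -
          have "h\<^sup>2 \<le> \<bar>t\<bar>\<^sup>2" using False h(1) by (intro power_mono) auto
          hence "(real n * d) * h\<^sup>2 \<le> (real n * d) * t\<^sup>2" using d by (intro mult_left_mono) auto
          hence "real n * (d * h\<^sup>2) \<le> x" by (simp add: x_def mult_ac)
          also have "x \<le> exp x" using exp_ge_add_one_self[of x] by linarith
          finally show ?thesis .
        qed
        hence "real n \<le> 1 / (d * h\<^sup>2) * exp x" using d h(1) by (simp add: field_simps)
        moreover have "1 / (d * h\<^sup>2) * exp x \<le> C * exp x"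
          by (intro mult_right_mono) (auto simp: C_def)
        ultimately have "\<rho> \<le> C * exp x" by simp
        hence "\<rho> * exp (- (2 * x)) \<le> C * exp x * exp (- (2 * x))" by (intro mult_right_mono) auto
        also have "\<dots> = C * exp (- x)" by (simp add: mult.assoc flip: exp_add)
        finally show ?thesis .
      qed
      with f_le show "norm (f n t) \<le> C * exp (- d * real n * t\<^sup>2)" by (simp add: x_def)
    qed
    fix s :: real
    have T: "(\<lambda>n. s / sqrt (real n)) \<longlonglongrightarrow> 0" by real_asymp
    have arc_lim: "(\<lambda>n. saddle_circle r (s / sqrt (real n))) \<longlonglongrightarrow> u" "(\<lambda>n. saddle_circle r (- (s / sqrt (real n)))) \<longlonglongrightarrow> u"
      unfolding u_def using T tendsto_minus[OF T]
      by (auto intro!: isCont_tendsto_compose[OF isCont_saddle_circle])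
    have "(\<lambda>n. (sqrt n * R n (saddle_circle r (s / sqrt n))) * (sqrt n * R n (saddle_circle r (- (s / sqrt n)))) * Q (s / sqrt n) ^ (2 * n))
       \<longlonglongrightarrow> (A * A) * exp (- k * (of_real s)\<^sup>2)"
      unfolding R_def A_def by (intro tendsto_mult shifted_legendre_asymptotic arc_lim u Q_lim)
    moreover have sq: "complex_of_real (sqrt (real n)) * complex_of_real (sqrt (real n)) = of_nat n" for n
      by (simp flip: of_real_mult)
    have "(sqrt n * R n (saddle_circle r (s / sqrt n))) * (sqrt n * R n (saddle_circle r (- (s / sqrt n)))) * Q (s / sqrt n) ^ (2 * n) = f n (s / sqrt n)" for n
      unfolding f_eq sq[symmetric] by (simp only: mult_ac)
    ultimately show "(\<lambda>n. f n (s / sqrt (real n))) \<longlonglongrightarrow> (A * A) * exp (- k * (of_real s)\<^sup>2)"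
      by simp
  qed simp
  thus ?thesis by (simp add: A)
qed

text \<open>
  The normalised integral converges, and dividing by \<open>norm (growth u) ^ (4 * n)\<close> instead of
  \<open>growth u ^ (4 * n)\<close> leaves the unimodular factor that produces the oscillation.
\<close>
lemma apery_poly_negative_asymptotic:
  assumes r: "r > 0"
  defines "u \<equiv> saddle_circle r 0"
  defines "k \<equiv> csqrt u / (2 * csqrt (1 + u) ^ 3)"
  defines "I \<equiv> 1 / (2 * pi * curvature u) * (of_real (sqrt pi) / csqrt k)"
  shows "(\<lambda>n. real n * sqrt (real n) * apery_poly n (- (r\<^sup>2)) / norm (growth u) ^ (4 * n)
              - Re (sgn (growth u) ^ (4 * n) * I) / pi) \<longlonglongrightarrow> 0"
proof -
  define J where "J = (\<lambda>n. sqrt (real n) * integral {-(pi/2)..pi/2} (\<lambda>t. of_nat n * (shifted_legendre n (saddle_circle r t) * shifted_legendre n (saddle_circle r (-t))) / growth u ^ (4 * n)))"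
  have "J \<longlonglongrightarrow> I"
    unfolding J_def I_def k_def u_def by (rule half_circle_integral_asymptotic[OF r])
  hence "(\<lambda>n. norm (J n - I)) \<longlonglongrightarrow> 0" by (simp add: LIM_zero_iff tendsto_norm_zero_iff)
  hence "(\<lambda>n. norm (J n - I) / pi) \<longlonglongrightarrow> 0" by (simp add: tendsto_divide_zero)
  thus ?thesis
  proof (rule Lim_null_comparison[rotated], intro always_eventually allI)
    fix n
    define W where "W = growth u"
    have W: "W \<noteq> 0" by (simp add: W_def growth_nonzero)
    define X where "X = integral {-(pi/2)..pi/2} (\<lambda>t. shifted_legendre n (saddle_circle r t) * shifted_legendre n (saddle_circle r (-t)))"
    have "integral {-(pi/2)..pi/2} (\<lambda>t. of_nat n * (shifted_legendre n (saddle_circle r t) * shifted_legendre n (saddle_circle r (-t))) / W ^ (4 * n)) = of_nat n / W ^ (4 * n) * X"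
      unfolding X_def by (subst integral_mult_right[symmetric]) (simp add: field_simps)
    hence J: "J n = sqrt (real n) * (of_nat n / W ^ (4 * n) * X)" by (simp add: J_def W_def)
    have "sgn W ^ (4 * n) * J n = of_real (sqrt (real n) * real n / norm W ^ (4 * n)) * X"
      unfolding J using W by (simp add: sgn_eq power_divide)
    hence ReJ: "Re (sgn W ^ (4 * n) * J n) = sqrt (real n) * real n / norm W ^ (4 * n) * Re X"
      by (simp del: of_real_mult of_real_divide)
    have "pi * apery_poly n (- (r\<^sup>2)) = Re X"
      unfolding X_def saddle_circle_def by (rule apery_poly_eq_integral)
    hence "apery_poly n (- (r\<^sup>2)) = Re X / pi" by (simp add: field_simps)
    hence "real n * sqrt (real n) * apery_poly n (- (r\<^sup>2)) / norm W ^ (4 * n) = Re (sgn W ^ (4 * n) * J n) / pi"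
      unfolding ReJ by (simp add: mult_ac)
    hence "real n * sqrt (real n) * apery_poly n (- (r\<^sup>2)) / norm W ^ (4 * n) - Re (sgn W ^ (4 * n) * I) / pi
        = Re (sgn W ^ (4 * n) * (J n - I)) / pi"
      by (simp add: right_diff_distrib diff_divide_distrib)
    also have "norm \<dots> \<le> norm (sgn W ^ (4 * n) * (J n - I)) / pi"
      using abs_Re_le_cmod[of "sgn W ^ (4 * n) * (J n - I)"] by (simp add: divide_right_mono abs_divide)
    also have "\<dots> = norm (J n - I) / pi"
      using W by (simp add: norm_mult norm_power norm_sgn)
    finally show "norm (real n * sqrt (real n) * apery_poly n (- (r\<^sup>2)) / norm (growth u) ^ (4 * n)
              - Re (sgn (growth u) ^ (4 * n) * I) / pi) \<le> norm (J n - I) / pi"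
      by (simp add: W_def)
  qed
qed

section \<open>The saddle contribution in terms of the angle\<close>

lemma cis_mult_sqrt2: "cis (pi / 4) = of_real (1 / sqrt 2) * (1 + \<i>)"
  by (simp add: complex_eq_iff cos_45 sin_45 real_div_sqrt field_simps)

lemma csqrt_saddle_circle:
  assumes S: "S > 0" and C: "C > 0"
  shows "csqrt (saddle_circle (S\<^sup>2 / (2 * C)) 0) = of_real (S / sqrt (2 * C)) * cis (pi / 4)"
proof (rule csqrt_unique)
  show "(of_real (S / sqrt (2 * C)) * cis (pi / 4))\<^sup>2 = saddle_circle (S\<^sup>2 / (2 * C)) 0"
    using C by (simp add: saddle_circle_def power_mult_distrib power_divide Complex.DeMoivre flip: of_real_power)
  show "0 < Re (of_real (S / sqrt (2 * C)) * cis (pi / 4)) \<or> Re (of_real (S / sqrt (2 * C)) * cis (pi / 4)) = 0 \<and> 0 \<le> Im (of_real (S / sqrt (2 * C)) * cis (pi / 4))"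
    using S C cos_gt_zero_pi[of "pi/4"] by (intro disjI1) (auto intro!: mult_pos_pos divide_pos_pos)
qed

text \<open>
  The point \<open>z = 1 + \<i> * S\<^sup>2 / (2 * C)\<close> has the rational modulus \<open>(1 + C\<^sup>2) / (2 * C)\<close>, and \<open>norm z \<plusminus> Re z\<close> are
  \<open>(1 \<plusminus> C)\<^sup>2 / (2 * C)\<close>, so the real and imaginary parts of the root need no square root but that of \<open>C\<close>.
\<close>
lemma csqrt_one_plus_saddle_circle_cartesian:
  assumes C: "C > 0" and SC: "S\<^sup>2 + C\<^sup>2 = 1"
  shows "csqrt (1 + saddle_circle (S\<^sup>2 / (2 * C)) 0) = Complex ((1 + C) / (2 * sqrt C)) ((1 - C) / (2 * sqrt C))"
proof (rule csqrt_unique)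
  have S2: "S\<^sup>2 = 1 - C * C" using SC by (simp add: power2_eq_square)
  have sq: "sqrt C * sqrt C = C" using C by simp
  show "(Complex ((1 + C) / (2 * sqrt C)) ((1 - C) / (2 * sqrt C)))\<^sup>2 = 1 + saddle_circle (S\<^sup>2 / (2 * C)) 0"
    using C unfolding S2
    by (simp add: complex_eq_iff saddle_circle_def Re_power2 Im_power2 power_divide) (simp add: field_simps power2_eq_square sq)
  have "0 < (1 + C) / (2 * sqrt C)" using C by simp
  thus "0 < Re (Complex ((1 + C) / (2 * sqrt C)) ((1 - C) / (2 * sqrt C))) \<or> Re (Complex ((1 + C) / (2 * sqrt C)) ((1 - C) / (2 * sqrt C))) = 0 \<and> 0 \<le> Im (Complex ((1 + C) / (2 * sqrt C)) ((1 - C) / (2 * sqrt C)))"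
    by simp
qed

lemma csqrt_one_plus_saddle_circle_polar:
  assumes C: "C > 0" and SC: "S\<^sup>2 + C\<^sup>2 = 1"
  shows "csqrt (1 + saddle_circle (S\<^sup>2 / (2 * C)) 0) = of_real (sqrt ((1 + C\<^sup>2) / (2 * C))) * cis (pi / 4 - arctan C)"
proof -
  define q where "q = sqrt (1 + C\<^sup>2)"
  have q: "q > 0" by (simp add: q_def add_pos_nonneg)
  have \<rho>: "sqrt ((1 + C\<^sup>2) / (2 * C)) = q / (sqrt 2 * sqrt C)"
    by (simp add: q_def real_sqrt_divide real_sqrt_mult)
  have trig: "cos (pi / 4 - arctan C) = (1 + C) / (sqrt 2 * q)" "sin (pi / 4 - arctan C) = (1 - C) / (sqrt 2 * q)"
    unfolding cos_diff sin_diff cos_arctan sin_arctan q_def[symmetric] cos_45 sin_45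
    using q by (simp_all add: field_simps)
  have "(1 + C) / (2 * sqrt C) = q / (sqrt 2 * sqrt C) * cos (pi / 4 - arctan C)"
       "(1 - C) / (2 * sqrt C) = q / (sqrt 2 * sqrt C) * sin (pi / 4 - arctan C)"
    unfolding trig using C q by (simp_all add: field_simps)
  hence "Complex ((1 + C) / (2 * sqrt C)) ((1 - C) / (2 * sqrt C)) = of_real (q / (sqrt 2 * sqrt C)) * cis (pi / 4 - arctan C)"
    by (intro complex_eqI) (simp_all del: of_real_divide of_real_mult)
  thus ?thesis
    unfolding csqrt_one_plus_saddle_circle_cartesian[OF assms] \<rho> .
qed

text \<open>
  The half angle turns the Cartesian parts into multiples of \<open>cos h\<close> and \<open>sin h\<close> with the common factor
  \<open>cos h + sin h\<close>, whose square is \<open>1 + S\<close>.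
\<close>
lemma growth_saddle_circle_polar:
  assumes h: "0 < h" "h < pi / 4"
  defines "S \<equiv> sin (2 * h)" and "C \<equiv> cos (2 * h)"
  shows "growth (saddle_circle (S\<^sup>2 / (2 * C)) 0) = of_real (sqrt ((1 + S) / C)) * cis h"
proof -
  have C: "C > 0" unfolding C_def using h by (intro cos_gt_zero_pi) auto
  have S: "S > 0" unfolding S_def using h by (intro sin_gt_zero) auto
  have SC: "S\<^sup>2 + C\<^sup>2 = 1" by (simp add: S_def C_def)
  define c s where "c = cos h" and "s = sin h"
  have cs: "c > 0" "s > 0" unfolding c_def s_def using h by (auto intro!: cos_gt_zero_pi sin_gt_zero)
  have "c\<^sup>2 + s\<^sup>2 = 1" by (simp add: c_def s_def)
  have S_eq: "S = 2 * s * c" and C_eq: "C = c\<^sup>2 - s\<^sup>2"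
    by (simp_all add: S_def C_def s_def c_def sin_double cos_double)
  have "1 + S = (c + s)\<^sup>2" using \<open>c\<^sup>2 + s\<^sup>2 = 1\<close> unfolding S_eq by algebra
  hence root: "sqrt ((1 + S) / C) = (c + s) / sqrt C" using cs by (simp add: real_sqrt_divide)
  have "1 + C + S = 2 * ((c + s) * c)" "1 - C + S = 2 * ((c + s) * s)"
    using \<open>c\<^sup>2 + s\<^sup>2 = 1\<close> unfolding S_eq C_eq by algebra+
  hence e: "(1 + C) / (2 * sqrt C) + S / (2 * sqrt C) = (c + s) / sqrt C * c" "(1 - C) / (2 * sqrt C) + S / (2 * sqrt C) = (c + s) / sqrt C * s"
    by (simp_all flip: add_divide_distrib)
  have "sqrt 2 * sqrt 2 = (2::real)" by simp
  hence a: "csqrt (saddle_circle (S\<^sup>2 / (2 * C)) 0) = Complex (S / (2 * sqrt C)) (S / (2 * sqrt C))"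
    unfolding csqrt_saddle_circle[OF S C] cis_mult_sqrt2 by (simp add: complex_eq_iff real_sqrt_mult field_simps)
  show ?thesis
    unfolding growth_def a csqrt_one_plus_saddle_circle_cartesian[OF C SC] root
    using e by (simp add: complex_eq_iff add.commute c_def s_def)
qed

text \<open>
  Subtraction theorem for the tangent, with \<open>tan (pi / 4 - h) = C / (1 + S)\<close>.
\<close>
lemma arctan_phase_identity:
  assumes h: "0 < h" "h < pi / 4"
  defines "S \<equiv> sin (2 * h)" and "C \<equiv> cos (2 * h)"
  shows "arctan (tan (2 * h) * (1 + S) / (2 + S)) = arctan (1 / C) + h - pi / 4"
proof (rule arctan_unique)
  have C: "C > 0" unfolding C_def using h by (intro cos_gt_zero_pi) auto
  have S: "S > 0" unfolding S_def using h by (intro sin_gt_zero) auto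
  have "C < 1" unfolding C_def using h cos_monotone_0_pi[of 0 "2 * h"] by simp
  hence "arctan (1 / C) > arctan 1" using C by (subst arctan_less_iff) auto
  hence gt: "arctan (1 / C) > pi / 4" by (simp add: arctan_one)
  thus "- (pi / 2) < arctan (1 / C) + h - pi / 4" using h by simp
  show "arctan (1 / C) + h - pi / 4 < pi / 2" using h arctan_ubound[of "1 / C"] by simp
  define c s where "c = cos h" and "s = sin h"
  have cs: "c > 0" "s > 0" unfolding c_def s_def using h by (auto intro!: cos_gt_zero_pi sin_gt_zero)
  have cs1: "c\<^sup>2 + s\<^sup>2 = 1" by (simp add: c_def s_def)
  have S_eq: "S = 2 * s * c" and C_eq: "C = c\<^sup>2 - s\<^sup>2"
    by (simp_all add: S_def C_def s_def c_def sin_double cos_double)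
  have "tan (pi / 4 - h) = (c - s) / (c + s)"
  proof -
    have "sqrt 2 / 2 * c - sqrt 2 / 2 * s = sqrt 2 / 2 * (c - s)"
      by (simp add: algebra_simps)
    moreover have "sqrt 2 / 2 * c + sqrt 2 / 2 * s = sqrt 2 / 2 * (c + s)"
      by (simp add: algebra_simps)
    ultimately show ?thesis
      unfolding tan_def sin_diff cos_diff cos_45 sin_45 c_def[symmetric] s_def[symmetric] by (simp only:) simp
  qed
  also have "\<dots> = C / (1 + S)"
  proof -
    have "(c - s) * (1 + S) = C * (c + s)" using cs1 unfolding S_eq C_eq by algebra
    thus ?thesis using cs S by (simp add: frac_eq_eq)
  qed
  finally have t1: "tan (pi / 4 - h) = C / (1 + S)" .
  have "cos (pi / 4 - h) \<noteq> 0" "cos (arctan (1 / C) - (pi / 4 - h)) \<noteq> 0"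
    using h gt arctan_ubound[of "1 / C"] by (intro less_imp_neq[symmetric] cos_gt_zero_pi; simp)+
  hence "tan (arctan (1 / C) - (pi / 4 - h)) = (1 / C - C / (1 + S)) / (1 + 1 / C * (C / (1 + S)))"
    by (subst tan_diff) (simp_all add: tan_arctan t1)
  also have "\<dots> = S / C * (1 + S) / (2 + S)"
  proof -
    have "C * C = 1 - S * S" using sin_cos_squared_add[of "2 * h"] by (simp add: S_def C_def power2_eq_square)
    hence "(1 + S) - C * C = S * (1 + S)" by (simp add: algebra_simps)
    moreover have "1 / C - C / (1 + S) = ((1 + S) - C * C) / (C * (1 + S))"
      using C S by (subst diff_frac_eq) auto
    ultimately have "1 / C - C / (1 + S) = S * (1 + S) / (C * (1 + S))" by simp
    hence "1 / C - C / (1 + S) = S / C" using S by simp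
    moreover have "1 + 1 / C * (C / (1 + S)) = (2 + S) / (1 + S)" using C S by (simp add: field_simps)
    ultimately show ?thesis using S by simp
  qed
  also have "S / C = tan (2 * h)" by (simp add: S_def C_def tan_def)
  finally show "tan (arctan (1 / C) + h - pi / 4) = tan (2 * h) * (1 + S) / (2 + S)"
    by (simp add: algebra_simps)
qed

text \<open>
  Collecting moduli and arguments. The delicate point is the branch of \<open>csqrt k\<close>: the argument of \<open>k\<close> is
  \<open>pi / 4 - 3 * \<beta>\<close> with \<open>0 < \<beta> < pi / 4\<close>, hence it stays within the right half plane and halving it gives the
  principal root.
\<close>
lemma saddle_contribution_polar:
  assumes h: "0 < h" "h < pi / 4"
  defines "S \<equiv> sin (2 * h)" and "C \<equiv> cos (2 * h)"
  defines "u \<equiv> saddle_circle (S\<^sup>2 / (2 * C)) 0"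
  defines "k \<equiv> csqrt u / (2 * csqrt (1 + u) ^ 3)"
  defines "a \<equiv> S / sqrt (2 * C)" and "\<rho> \<equiv> sqrt ((1 + C\<^sup>2) / (2 * C))"
  shows "1 / (2 * pi * curvature u) * (of_real (sqrt pi) / csqrt k)
     = of_real ((1 + S) / C * sqrt pi / (4 * pi * a * \<rho> * sqrt (a / (2 * \<rho> ^ 3)))) * cis (2 * h - pi / 4 - arctan C / 2)"
proof -
  have C: "C > 0" unfolding C_def using h by (intro cos_gt_zero_pi) auto
  have S: "S > 0" unfolding S_def using h by (intro sin_gt_zero) auto
  have SC: "S\<^sup>2 + C\<^sup>2 = 1" by (simp add: S_def C_def)
  have a: "a > 0" unfolding a_def using S C by simp
  have \<rho>: "\<rho> > 0" unfolding \<rho>_def using C by (simp add: add_pos_nonneg)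
  define \<beta> where "\<beta> = pi / 4 - arctan C"
  have "C < 1" unfolding C_def using h cos_monotone_0_pi[of 0 "2 * h"] by simp
  hence "arctan C < pi / 4" using arctan_less_iff[of C 1] by (simp add: arctan_one)
  moreover have "arctan C > 0" using C by simp
  ultimately have \<beta>: "0 < \<beta>" "\<beta> < pi / 4" by (auto simp: \<beta>_def)
  have A: "csqrt u = of_real a * cis (pi / 4)"
    unfolding u_def a_def by (rule csqrt_saddle_circle[OF S C])
  have B: "csqrt (1 + u) = of_real \<rho> * cis \<beta>"
    unfolding u_def \<rho>_def \<beta>_def by (rule csqrt_one_plus_saddle_circle_polar[OF C SC])
  have W: "(growth u)\<^sup>2 = of_real ((1 + S) / C) * cis (2 * h)"
  proof -
    have "(growth u)\<^sup>2 = of_real ((sqrt ((1 + S) / C))\<^sup>2) * cis (2 * h)"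
      unfolding u_def S_def C_def growth_saddle_circle_polar[OF h] by (simp add: power_mult_distrib Complex.DeMoivre)
    thus ?thesis using S C by simp
  qed
  have k: "k = of_real (a / (2 * \<rho> ^ 3)) * cis (pi / 4 - 3 * \<beta>)"
    unfolding k_def A B by (simp add: power_mult_distrib Complex.DeMoivre cis_divide[symmetric])
  have K: "csqrt k = of_real (sqrt (a / (2 * \<rho> ^ 3))) * cis (pi / 8 - 3 * \<beta> / 2)"
  proof (rule csqrt_unique)
    have "(sqrt (a / (2 * \<rho> ^ 3)))\<^sup>2 = a / (2 * \<rho> ^ 3)" using a \<rho> by simp
    thus "(of_real (sqrt (a / (2 * \<rho> ^ 3))) * cis (pi / 8 - 3 * \<beta> / 2))\<^sup>2 = k"
      unfolding k power_mult_distrib of_real_power[symmetric] Complex.DeMoivre by (simp add: algebra_simps)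
    have "cos (pi / 8 - 3 * \<beta> / 2) > 0" using \<beta> by (intro cos_gt_zero_pi) auto
    hence "Re (of_real (sqrt (a / (2 * \<rho> ^ 3))) * cis (pi / 8 - 3 * \<beta> / 2)) > 0"
      using a \<rho> by simp
    thus "0 < Re (of_real (sqrt (a / (2 * \<rho> ^ 3))) * cis (pi / 8 - 3 * \<beta> / 2)) \<or> Re (of_real (sqrt (a / (2 * \<rho> ^ 3))) * cis (pi / 8 - 3 * \<beta> / 2)) = 0 \<and> 0 \<le> Im (of_real (sqrt (a / (2 * \<rho> ^ 3))) * cis (pi / 8 - 3 * \<beta> / 2))"
      by simp
  qed
  have "1 / (2 * pi * curvature u) * (of_real (sqrt pi) / csqrt k)
      = of_real ((1 + S) / C * sqrt pi / (4 * pi * a * \<rho> * sqrt (a / (2 * \<rho> ^ 3)))) * (cis (2 * h) / (cis (pi / 4) * cis \<beta> * cis (pi / 8 - 3 * \<beta> / 2)))"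
    unfolding curvature_def A B W K by (simp add: mult_ac)
  also have "cis (2 * h) / (cis (pi / 4) * cis \<beta> * cis (pi / 8 - 3 * \<beta> / 2)) = cis (2 * h - pi / 4 - arctan C / 2)"
    unfolding cis_mult cis_divide by (rule arg_cong[of _ _ cis]) (simp add: \<beta>_def field_simps)
  finally show ?thesis .
qed

text \<open>
  Both sides are positive and involve nothing worse than fourth roots of rational functions of \<open>S\<close> and \<open>C\<close>, so
  it suffices to compare their fourth powers.
\<close>
lemma saddle_amplitude:
  assumes S: "S > 0" and C: "C > 0" 
  defines "a \<equiv> S / sqrt (2 * C)" and "\<rho> \<equiv> sqrt ((1 + C\<^sup>2) / (2 * C))"
  assumes SC: "S\<^sup>2 + C\<^sup>2 = 1"
  shows "(2 * pi) powr (3 / 2) * ((1 + S) / C * sqrt pi / (4 * pi * a * \<rho> * sqrt (a / (2 * \<rho> ^ 3))) / pi)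
    = (1 + S) * (1 + 1 / 2 * (S / C)\<^sup>2) / (1 / 2 * (S / C) * sqrt (1 + C\<^sup>2)) powr (3 / 2)"
proof -
  have powr: "x powr (3 / 2) = x * sqrt x" if "x > 0" for x :: real
  proof -
    have "x powr (3 / 2) = x powr (1 + 1 / 2)" by simp
    also have "\<dots> = x * sqrt x" using that by (subst powr_add) (simp add: powr_half_sqrt)
    finally show ?thesis .
  qed
  have a: "a > 0" unfolding a_def using S C by simp
  have \<rho>: "\<rho> > 0" unfolding \<rho>_def using C by (simp add: add_pos_nonneg)
  define z where "z = 1 / 2 * (S / C) * sqrt (1 + C\<^sup>2)"
  have q: "sqrt (1 + C\<^sup>2) > 0" by (simp add: add_pos_nonneg)
  have z: "z > 0" unfolding z_def using S C q by (intro mult_pos_pos divide_pos_pos) auto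
  define m where "m = a / (2 * \<rho> ^ 3)"
  have m: "m > 0" using a \<rho> by (simp add: m_def)
  have "(2 * pi) powr (3 / 2) * ((1 + S) / C * sqrt pi / (4 * pi * a * \<rho> * sqrt m) / pi)
      = (2 * pi * sqrt (2 * pi)) * ((1 + S) / C * sqrt pi / (4 * pi * a * \<rho> * sqrt m) / pi)"
    by (subst powr) auto
  also have "\<dots> = (1 + S) / C * sqrt 2 / (2 * a * \<rho> * sqrt m)"
  proof -
    have "sqrt (2 * pi) * sqrt pi = sqrt 2 * pi" by (simp add: real_sqrt_mult)
    thus ?thesis using a \<rho> m C by (simp add: field_simps)
  qed
  also have "\<dots> = (1 + S) * (1 + 1 / 2 * (S / C)\<^sup>2) / (z * sqrt z)"
  proof (rule power_eq_imp_eq_base[where n = 4])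
    have four: "sqrt t ^ 4 = t\<^sup>2" if "t > 0" for t :: real
      using that by (simp add: power4_eq_xxxx power2_eq_square)
    have a2: "a\<^sup>2 = S\<^sup>2 / (2 * C)" using C by (simp add: a_def power_divide)
    have \<rho>2: "\<rho>\<^sup>2 = (1 + C\<^sup>2) / (2 * C)" using C by (simp add: \<rho>_def)
    have z2: "z\<^sup>2 = S\<^sup>2 * (1 + C\<^sup>2) / (4 * C\<^sup>2)"
      by (simp add: z_def power_mult_distrib power_divide)
    have "((1 + S) / C * sqrt 2 / (2 * a * \<rho> * sqrt m)) ^ 4 = ((1 + S) / C) ^ 4 * 4 / (16 * a ^ 4 * \<rho> ^ 4 * m\<^sup>2)"
      using m by (simp add: power_mult_distrib power_divide four)
    also have "\<dots> = ((1 + S) / C) ^ 4 * \<rho>\<^sup>2 / (a\<^sup>2) ^ 3"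
    proof -
      have "m\<^sup>2 * (4 * \<rho> ^ 6) = a\<^sup>2"
        using \<rho> by (simp add: m_def power_divide power_mult_distrib flip: power_mult)
      hence "16 * a ^ 4 * \<rho> ^ 4 * m\<^sup>2 * \<rho>\<^sup>2 = 4 * (a\<^sup>2) ^ 3" by algebra
      hence "((1 + S) / C) ^ 4 * 4 * (a\<^sup>2) ^ 3 = ((1 + S) / C) ^ 4 * \<rho>\<^sup>2 * (16 * a ^ 4 * \<rho> ^ 4 * m\<^sup>2)"
        by algebra
      thus ?thesis using a \<rho> m by (subst frac_eq_eq) auto
    qed
    also have "\<dots> = 4 * (1 + S) ^ 4 * (1 + C\<^sup>2) / (C\<^sup>2 * S ^ 6)"
      unfolding a2 \<rho>2 using S C by (simp add: power_divide power_mult_distrib field_simps flip: power_mult) algebra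
    finally have L: "((1 + S) / C * sqrt 2 / (2 * a * \<rho> * sqrt m)) ^ 4 = 4 * (1 + S) ^ 4 * (1 + C\<^sup>2) / (C\<^sup>2 * S ^ 6)" .
    have half: "1 + 1 / 2 * (S / C)\<^sup>2 = (1 + C\<^sup>2) / (2 * C\<^sup>2)"
      using C SC by (simp add: power_divide field_simps)
    have "((1 + S) * (1 + 1 / 2 * (S / C)\<^sup>2) / (z * sqrt z)) ^ 4 = (1 + S) ^ 4 * ((1 + C\<^sup>2) / (2 * C\<^sup>2)) ^ 4 / (z\<^sup>2) ^ 3"
      unfolding half using z by (simp add: power_mult_distrib power_divide four flip: power_mult power_add)
    also have "\<dots> = 4 * (1 + S) ^ 4 * (1 + C\<^sup>2) / (C\<^sup>2 * S ^ 6)"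
    proof -
      define p where "p = 1 + C\<^sup>2"
      have p: "p > 0" by (simp add: p_def add_pos_nonneg)
      show ?thesis unfolding z2 p_def[symmetric] using S C p
        by (simp add: power_divide power_mult_distrib field_simps flip: power_mult) (simp add: eval_nat_numeral)
    qed
    finally show "((1 + S) / C * sqrt 2 / (2 * a * \<rho> * sqrt m)) ^ 4 = ((1 + S) * (1 + 1 / 2 * (S / C)\<^sup>2) / (z * sqrt z)) ^ 4"
      using L by simp
    show "0 \<le> (1 + S) / C * sqrt 2 / (2 * a * \<rho> * sqrt m)"
      using S C a \<rho> m by simp
    show "0 \<le> (1 + S) * (1 + 1 / 2 * (S / C)\<^sup>2) / (z * sqrt z)"
      using S z by (simp add: add_nonneg_nonneg)
  qed simp
  also have "z * sqrt z = z powr (3 / 2)" using z by (simp add: powr)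
  finally show ?thesis by (simp add: z_def m_def)
qed

section \<open>The parameter and the asymptotic formula\<close>

text \<open>
  With \<open>c = cos (pi / 2 * \<theta>)\<close> the parametrisation reads \<open>sqrt x = (1 - c\<^sup>2) / (2 * c)\<close>, and \<open>c\<close> is the
  positive root of \<open>c\<^sup>2 + 2 * c * sqrt x = 1\<close>.
\<close>
lemma apery_param_iff:
  assumes th: "0 < \<theta>" "\<theta> < 1" and x: "x > 0"
  shows "x = apery_param \<theta> \<longleftrightarrow> cos (pi / 2 * \<theta>) = sqrt (1 + x) - sqrt x"
proof -
  define c where "c = cos (pi / 2 * \<theta>)"
  have c: "c > 0" unfolding c_def using th by (intro cos_gt_zero_pi) (auto intro: less_trans[of _ 0])
  have "c \<le> 1" by (simp add: c_def)
  hence c2: "c\<^sup>2 \<le> 1" using c by (simp add: power_le_one)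
  have "sin (pi / 2 * \<theta>) ^ 4 = (1 - c\<^sup>2)\<^sup>2"
    by (simp add: c_def sin_squared_eq[symmetric] flip: power_mult)
  hence p: "apery_param \<theta> = ((1 - c\<^sup>2) / (2 * c))\<^sup>2"
    by (simp add: apery_param_def c_def power_divide power_mult_distrib)
  show ?thesis
  proof
    assume "x = apery_param \<theta>"
    hence x_eq: "x = ((1 - c\<^sup>2) / (2 * c))\<^sup>2" by (simp add: p)
    hence "1 + x = ((1 + c\<^sup>2) / (2 * c))\<^sup>2"
      using c by (simp add: power_divide field_simps power2_eq_square)
    hence "sqrt (1 + x) = (1 + c\<^sup>2) / (2 * c)" using c by (simp add: add_nonneg_nonneg)
    moreover have "sqrt x = (1 - c\<^sup>2) / (2 * c)" unfolding x_eq using c c2 by simp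
    ultimately have "sqrt (1 + x) - sqrt x = c"
      using c by (simp add: power2_eq_square flip: diff_divide_distrib)
    thus "cos (pi / 2 * \<theta>) = sqrt (1 + x) - sqrt x" unfolding c_def by (rule sym)
  next
    assume "cos (pi / 2 * \<theta>) = sqrt (1 + x) - sqrt x"
    hence "(c + sqrt x)\<^sup>2 = (sqrt (1 + x))\<^sup>2" by (simp add: c_def)
    hence "1 - c\<^sup>2 = 2 * c * sqrt x" using x by (simp add: power2_sum)
    thus "x = apery_param \<theta>" using c x by (simp add: p)
  qed
qed

lemma ex1_apery_param:
  assumes x: "x > 0"
  shows "\<exists>!\<theta>. 0 < \<theta> \<and> \<theta> < 1 \<and> x = apery_param \<theta>"
proof -
  define c where "c = sqrt (1 + x) - sqrt x"
  have "(sqrt (1 + x))\<^sup>2 < (1 + sqrt x)\<^sup>2" using x by (simp add: power2_sum)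
  hence "sqrt (1 + x) < 1 + sqrt x" using x by (rule_tac power2_less_imp_less) auto
  hence c: "0 < c" "c < 1" by (simp_all add: c_def)
  define \<theta>0 where "\<theta>0 = 2 / pi * arccos c"
  have ac: "0 < arccos c" "arccos c < pi / 2"
    using c arccos_less_mono[of 1 c] arccos_less_mono[of c 0] by auto
  hence th0: "0 < \<theta>0" "\<theta>0 < 1" by (simp_all add: \<theta>0_def field_simps)
  have "cos (pi / 2 * \<theta>0) = c" using c by (simp add: \<theta>0_def)
  hence "x = apery_param \<theta>0" using apery_param_iff[OF th0 x] by (simp add: c_def)
  moreover have "\<theta> = \<theta>0" if "0 < \<theta>" "\<theta> < 1" "x = apery_param \<theta>" for \<theta>
  proof -
    have "cos (pi / 2 * \<theta>) = c" using apery_param_iff[OF that(1,2) x] that(3) by (simp add: c_def)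
    hence "arccos c = pi / 2 * \<theta>" using that arccos_cos[of "pi / 2 * \<theta>"] by (auto simp: mult_le_cancel_left1)
    thus ?thesis by (simp add: \<theta>0_def field_simps)
  qed
  ultimately show ?thesis using th0 by blast
qed

theorem theorem4p2:
  fixes x :: real
  assumes "x > 0"
  shows "(\<exists>!\<theta>. 0 < \<theta> \<and> \<theta> < 1 \<and> x = apery_param \<theta>) \<and>
    (\<forall>\<theta>. 0 < \<theta> \<and> \<theta> < 1 \<and> x = apery_param \<theta> \<longrightarrow>
      (\<exists>\<epsilon> :: nat \<Rightarrow> real. \<epsilon> \<longlonglongrightarrow> 0 \<and>
        (\<forall>\<^sub>F n in sequentially.
          apery_poly n (- x) =
            1 / (2 * pi * real n) powr (3 / 2)
            * ((1 + sin (pi / 2 * \<theta>)) * (1 + 1 / 2 * (tan (pi / 2 * \<theta>))\<^sup>2)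
               / (1 / 2 * tan (pi / 2 * \<theta>) * sqrt (1 + (cos (pi / 2 * \<theta>))\<^sup>2)) powr (3 / 2))
            * ((1 + sin (pi / 2 * \<theta>)) / cos (pi / 2 * \<theta>)) ^ (2 * n)
            * (cos (apery_phase \<theta> + real n * pi * \<theta>) + \<epsilon> n))))"
proof (intro conjI allI impI ex1_apery_param assms)
  fix \<theta> :: real
  assume \<theta>: "0 < \<theta> \<and> \<theta> < 1 \<and> x = apery_param \<theta>"
  define h where "h = pi / 4 * \<theta>"
  have h: "0 < h" "h < pi / 4" using \<theta> by (auto simp: h_def)
  have h2: "pi / 2 * \<theta> = 2 * h" by (simp add: h_def)
  define S C where "S = sin (2 * h)" and "C = cos (2 * h)"
  have C: "C > 0" unfolding C_def using h by (intro cos_gt_zero_pi) auto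
  have S: "S > 0" unfolding S_def using h by (intro sin_gt_zero) auto
  have SC: "S\<^sup>2 + C\<^sup>2 = 1" by (simp add: S_def C_def)
  have tan: "tan (2 * h) = S / C" by (simp add: tan_def S_def C_def)
  define r where "r = S\<^sup>2 / (2 * C)"
  have r: "r > 0" using S C by (simp add: r_def)
  have x: "x = r\<^sup>2"
    using \<theta> unfolding apery_param_def h2 S_def[symmetric] C_def[symmetric]
    by (simp add: r_def power_divide power_mult_distrib flip: power_mult)
  define b where "b = (1 + S) / C"
  have b: "b > 0" using S C by (simp add: b_def)
  define W where "W = growth (saddle_circle r 0)"
  have W: "W = of_real (sqrt b) * cis h"
    unfolding W_def r_def b_def S_def C_def by (rule growth_saddle_circle_polar[OF h])
  have normW: "norm W ^ (4 * n) = b ^ (2 * n)" for n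
  proof -
    have "norm W ^ (4 * n) = sqrt b ^ (2 * (2 * n))"
      using b unfolding W norm_mult norm_of_real by simp
    also have "\<dots> = b ^ (2 * n)"
      using b by (simp only: power_mult[of _ 2] real_sqrt_pow2)
    finally show ?thesis .
  qed
  have sgnW: "sgn W ^ (4 * n) = cis (real n * pi * \<theta>)" for n
  proof -
    have "sgn W = cis h" using b by (simp add: W sgn_eq norm_mult)
    thus ?thesis by (simp add: Complex.DeMoivre h_def mult_ac)
  qed
  define a \<rho> where "a = S / sqrt (2 * C)" and "\<rho> = sqrt ((1 + C\<^sup>2) / (2 * C))"
  define K where "K = (1 + S) / C * sqrt pi / (4 * pi * a * \<rho> * sqrt (a / (2 * \<rho> ^ 3)))"
  define \<psi> where "\<psi> = 2 * h - pi / 4 - arctan C / 2"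
  note contribution = saddle_contribution_polar[OF h, folded S_def C_def, folded r_def a_def \<rho>_def, folded K_def \<psi>_def]
  have \<psi>: "\<psi> = apery_phase \<theta>"
  proof -
    have "arctan (1 / C) = pi / 2 - arctan C"
      using arctan_inverse[of C] C by (simp add: inverse_eq_divide)
    thus ?thesis
      unfolding apery_phase_def h2 using arctan_phase_identity[OF h]
      by (simp add: \<psi>_def S_def C_def field_simps)
  qed
  define P where "P = (1 + S) * (1 + 1 / 2 * (S / C)\<^sup>2) / (1 / 2 * (S / C) * sqrt (1 + C\<^sup>2)) powr (3 / 2)"
  have P: "P > 0"
  proof -
    have "1 / 2 * (S / C) * sqrt (1 + C\<^sup>2) > 0" using S C by (simp add: add_pos_nonneg)
    hence "(1 / 2 * (S / C) * sqrt (1 + C\<^sup>2)) powr (3 / 2) > 0" by (metis powr_gt_zero less_irrefl)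
    thus ?thesis unfolding P_def using S by (intro divide_pos_pos mult_pos_pos add_pos_nonneg) auto
  qed
  have KP: "(2 * pi) powr (3 / 2) * (K / pi) = P"
    unfolding K_def P_def a_def \<rho>_def by (rule saddle_amplitude[OF S C SC])
  define q where "q = (\<lambda>n. real n * sqrt (real n) * apery_poly n (- x) / b ^ (2 * n))"
  have "(\<lambda>n. q n - K * cos (apery_phase \<theta> + real n * pi * \<theta>) / pi) \<longlonglongrightarrow> 0"
    using apery_poly_negative_asymptotic[OF r, folded W_def] unfolding contribution normW sgnW
    by (simp add: q_def x \<psi> cis_mult mult.left_commute[of "cis _"] add.commute)
  hence "(\<lambda>n. (2 * pi) powr (3 / 2) / P * (q n - K * cos (apery_phase \<theta> + real n * pi * \<theta>) / pi)) \<longlonglongrightarrow> (2 * pi) powr (3 / 2) / P * 0"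
    by (rule tendsto_mult[OF tendsto_const])
  moreover have "(2 * pi) powr (3 / 2) / P * (K * t / pi) = t" for t
    using P KP by (simp add: field_simps)
  ultimately have lim: "(\<lambda>n. (2 * pi) powr (3 / 2) / P * q n - cos (apery_phase \<theta> + real n * pi * \<theta>)) \<longlonglongrightarrow> 0"
    by (simp add: right_diff_distrib)
  show "\<exists>\<epsilon> :: nat \<Rightarrow> real. \<epsilon> \<longlonglongrightarrow> 0 \<and>
        (\<forall>\<^sub>F n in sequentially.
          apery_poly n (- x) =
            1 / (2 * pi * real n) powr (3 / 2)
            * ((1 + sin (pi / 2 * \<theta>)) * (1 + 1 / 2 * (tan (pi / 2 * \<theta>))\<^sup>2)
               / (1 / 2 * tan (pi / 2 * \<theta>) * sqrt (1 + (cos (pi / 2 * \<theta>))\<^sup>2)) powr (3 / 2))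
            * ((1 + sin (pi / 2 * \<theta>)) / cos (pi / 2 * \<theta>)) ^ (2 * n)
            * (cos (apery_phase \<theta> + real n * pi * \<theta>) + \<epsilon> n))"
  proof (intro exI conjI)
    show "(\<lambda>n. (2 * pi) powr (3 / 2) / P * q n - cos (apery_phase \<theta> + real n * pi * \<theta>)) \<longlonglongrightarrow> 0"
      by (rule lim)
    show "\<forall>\<^sub>F n in sequentially.
          apery_poly n (- x) =
            1 / (2 * pi * real n) powr (3 / 2)
            * ((1 + sin (pi / 2 * \<theta>)) * (1 + 1 / 2 * (tan (pi / 2 * \<theta>))\<^sup>2)
               / (1 / 2 * tan (pi / 2 * \<theta>) * sqrt (1 + (cos (pi / 2 * \<theta>))\<^sup>2)) powr (3 / 2))
            * ((1 + sin (pi / 2 * \<theta>)) / cos (pi / 2 * \<theta>)) ^ (2 * n)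
            * (cos (apery_phase \<theta> + real n * pi * \<theta>)
               + ((2 * pi) powr (3 / 2) / P * q n - cos (apery_phase \<theta> + real n * pi * \<theta>)))"
      using eventually_gt_at_top[of 0]
    proof eventually_elim
      case (elim n)
      have "(2 * pi * real n) powr (3 / 2) = (2 * pi) powr (3 / 2) * (real n * sqrt (real n))"
        using elim powr_add[of "real n" 1 "1 / 2"] by (simp add: powr_mult powr_half_sqrt)
      moreover have "(2 * pi) powr (3 / 2) > 0" by simp
      ultimately show ?case
        unfolding h2 tan S_def[symmetric] C_def[symmetric] P_def[symmetric] b_def[symmetric]
        using P b elim by (simp add: q_def)
    qed
  qed
qed

end
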